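(* Let $(G,g)$ be a unimodular Riemannian Lie group of dimension $n$. Then $$\dim CH(g)=\frac{n(n-1)}{2}+\dim\mathrm{Kill}(g).$$
   Context: All Lie groups are real and connected. A Riemannian Lie group $(G,g)$ is a Lie group with a left invariant Riemannian metric; $\mathfrak g=T_eG$ is its Lie algebra with inner product $g(e)$. $G$ is unimodular if $\mathrm{tr}(\mathrm{ad}_u)=0$ for all $u\in\mathfrak g$. $\mathrm{Kill}(g)=\{u\in\mathfrak g:\mathrm{ad}_u+\mathrm{ad}_u^*=0\}$, where $*$ is the adjoint with respect to $g(e)$. The harmonic cone $CH(g)$ is the set of left invariant Riemannian metrics $h$ on $G$ such that $\mathrm{Id}_G:(G,g)\to(G,h)$ is harmonic (i.e. has vanishing tension field $\mathrm{tr}_g\nabla d\,\mathrm{Id}_G$); it is a convex cone in the vector space of left invariant symmetric bilinear forms, i.e. symmetric bilinear forms on $\mathfrak g$. $\dim CH(g)$ denotes the dimension of the linear subspace spanned by $CH(g)$. *)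

theory Defs
  imports "HOL-Analysis.Analysis" "HOL-Library.Function_Algebras"
begin

text \<open>Functions with values in a real vector space form a real vector space; this is the space in
  which tensor fields, in particular the metrics of the harmonic cone, are added and scaled.\<close>

instantiation "fun" :: (type, real_vector) real_vector
begin

definition "scaleR_fun r f = (\<lambda>x. r *\<^sub>R f x)" for f :: "'a \<Rightarrow> 'b"

instance
  by standard (simp_all add: scaleR_fun_def fun_eq_iff scaleR_add_right scaleR_add_left)

end


section \<open>Smooth functions on open sets\<close>

text \<open>These predicates are only meant for open subsets of finite-dimensional spaces, where the
  existence and continuity of iterated directional derivatives gives the usual notion.\<close>

primrec Ck_on :: "nat \<Rightarrow> 'a::real_normed_vector set \<Rightarrow> ('a \<Rightarrow> 'b::real_normed_vector) \<Rightarrow> bool" where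
  "Ck_on 0 S f \<longleftrightarrow> continuous_on S f"
| "Ck_on (Suc k) S f \<longleftrightarrow> (\<forall>x\<in>S. f differentiable (at x)) \<and>
     (\<forall>v. Ck_on k S (\<lambda>x. frechet_derivative f (at x) v))"

definition smooth_on :: "'a::real_normed_vector set \<Rightarrow> ('a \<Rightarrow> 'b::real_normed_vector) \<Rightarrow> bool" where
  "smooth_on S f \<longleftrightarrow> (\<forall>k. Ck_on k S f)"


section \<open>Smooth manifolds\<close>

text \<open>A manifold is a whole type with an atlas. A chart is a pair of its domain and a map that is
  meaningful on the domain only.\<close>

type_synonym ('a, 'e) chart = "'a set \<times> ('a \<Rightarrow> 'e)"

definition chart_inv :: "('a, 'e) chart \<Rightarrow> 'e \<Rightarrow> 'a" where
  "chart_inv c = inv_into (fst c) (snd c)"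

definition is_chart :: "('a::topological_space, 'e::euclidean_space) chart \<Rightarrow> bool" where
  "is_chart c \<longleftrightarrow> open (fst c) \<and> open (snd c ` fst c) \<and>
     homeomorphism (fst c) (snd c ` fst c) (snd c) (chart_inv c)"

definition smooth_atlas :: "('a::topological_space, 'e::euclidean_space) chart set \<Rightarrow> bool" where
  "smooth_atlas A \<longleftrightarrow> (\<forall>c\<in>A. is_chart c) \<and> (\<Union>c\<in>A. fst c) = UNIV \<and>
     (\<forall>c\<in>A. \<forall>d\<in>A. smooth_on (snd c ` (fst c \<inter> fst d)) (snd d \<circ> chart_inv c))"

definition local_rep :: "('a, 'e) chart \<Rightarrow> ('b, 'f) chart \<Rightarrow> ('a \<Rightarrow> 'b) \<Rightarrow> 'e \<Rightarrow> 'f" where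
  "local_rep c d f = snd d \<circ> f \<circ> chart_inv c"

definition smooth_map ::
  "('a::topological_space, 'e::euclidean_space) chart set \<Rightarrow>
   ('b::topological_space, 'f::euclidean_space) chart set \<Rightarrow> ('a \<Rightarrow> 'b) \<Rightarrow> bool" where
  "smooth_map A B f \<longleftrightarrow> continuous_on UNIV f \<and>
     (\<forall>c\<in>A. \<forall>d\<in>B. smooth_on (snd c ` (fst c \<inter> f -` fst d)) (local_rep c d f))"

definition prod_atlas ::
  "('a, 'e) chart set \<Rightarrow> ('b, 'f) chart set \<Rightarrow> ('a \<times> 'b, 'e \<times> 'f) chart set" where
  "prod_atlas A B = (\<lambda>(c, d). (fst c \<times> fst d, map_prod (snd c) (snd d))) ` (A \<times> B)"


section \<open>Tangent vectors\<close>

text \<open>Every point \<open>p\<close> has a preferred chart \<open>chart_at A p\<close>, and the tangent space at \<open>p\<close> is the model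
  space \<open>'e\<close>: a vector \<open>v\<close> stands for the tangent vector with components \<open>v\<close> in the preferred chart.
  Hence a vector field has type \<open>'a \<Rightarrow> 'e\<close>, and a covariant 2-tensor field has type
  \<open>'a \<Rightarrow> 'e \<Rightarrow> 'e \<Rightarrow> real\<close>. As the preferred chart varies with the point, such a field is
  differentiated only after it has been transferred to one fixed chart.\<close>

definition chart_at :: "('a, 'e) chart set \<Rightarrow> 'a \<Rightarrow> ('a, 'e) chart" where
  "chart_at A p = (SOME c. c \<in> A \<and> p \<in> fst c)"

definition mdiff ::
  "('a, 'e::euclidean_space) chart set \<Rightarrow> ('b, 'f::euclidean_space) chart set \<Rightarrow>
   ('a \<Rightarrow> 'b) \<Rightarrow> 'a \<Rightarrow> 'e \<Rightarrow> 'f" where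
  "mdiff A B f p =
     frechet_derivative (local_rep (chart_at A p) (chart_at B (f p)) f) (at (snd (chart_at A p) p))"

text \<open>Change of components between the preferred chart at \<open>q\<close> and a chart \<open>c\<close> around \<open>q\<close>.\<close>

definition tangent_to_chart ::
  "('a, 'e::euclidean_space) chart set \<Rightarrow> ('a, 'e) chart \<Rightarrow> 'a \<Rightarrow> 'e \<Rightarrow> 'e" where
  "tangent_to_chart A c q =
     frechet_derivative (local_rep (chart_at A q) c id) (at (snd (chart_at A q) q))"

definition tangent_from_chart ::
  "('a, 'e::euclidean_space) chart set \<Rightarrow> ('a, 'e) chart \<Rightarrow> 'a \<Rightarrow> 'e \<Rightarrow> 'e" where
  "tangent_from_chart A c q =
     frechet_derivative (local_rep c (chart_at A q) id) (at (snd c q))"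

definition field_rep ::
  "('a, 'e::euclidean_space) chart set \<Rightarrow> ('a, 'e) chart \<Rightarrow> ('a \<Rightarrow> 'e) \<Rightarrow> 'e \<Rightarrow> 'e" where
  "field_rep A c X x = tangent_to_chart A c (chart_inv c x) (X (chart_inv c x))"

definition form_rep ::
  "('a, 'e::euclidean_space) chart set \<Rightarrow> ('a, 'e) chart \<Rightarrow> ('a \<Rightarrow> 'e \<Rightarrow> 'e \<Rightarrow> real) \<Rightarrow>
   'e \<Rightarrow> 'e \<Rightarrow> 'e \<Rightarrow> real" where
  "form_rep A c g x u v =
     g (chart_inv c x) (tangent_from_chart A c (chart_inv c x) u)
       (tangent_from_chart A c (chart_inv c x) v)"

definition field_bracket ::
  "('a, 'e::euclidean_space) chart set \<Rightarrow> ('a \<Rightarrow> 'e) \<Rightarrow> ('a \<Rightarrow> 'e) \<Rightarrow> 'a \<Rightarrow> 'e" where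
  "field_bracket A X Y p =
     (let c = chart_at A p; x = snd c p
      in frechet_derivative (field_rep A c Y) (at x) (field_rep A c X x)
         - frechet_derivative (field_rep A c X) (at x) (field_rep A c Y x))"


section \<open>Riemannian metrics and harmonic maps\<close>

definition riemannian_metric ::
  "('a, 'e::euclidean_space) chart set \<Rightarrow> ('a \<Rightarrow> 'e \<Rightarrow> 'e \<Rightarrow> real) \<Rightarrow> bool" where
  "riemannian_metric A g \<longleftrightarrow>
     (\<forall>p. bilinear (g p) \<and> (\<forall>u v. g p u v = g p v u) \<and> (\<forall>u. u \<noteq> 0 \<longrightarrow> 0 < g p u u)) \<and>
     (\<forall>c\<in>A. \<forall>u v. smooth_on (snd c ` fst c) (\<lambda>x. form_rep A c g x u v))"

text \<open>The Christoffel symbols \<open>\<Gamma>(u, v)\<close> of the Levi-Civita connection in the chart \<open>c\<close> at \<open>x\<close>,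
  characterised by
  \<open>2 g(\<Gamma>(u, v), z) = \<partial>\<^sub>u g(v, z) + \<partial>\<^sub>v g(u, z) - \<partial>\<^sub>z g(u, v)\<close> for constant \<open>u\<close>, \<open>v\<close>, \<open>z\<close>.\<close>

definition christoffel ::
  "('a, 'e::euclidean_space) chart set \<Rightarrow> ('a \<Rightarrow> 'e \<Rightarrow> 'e \<Rightarrow> real) \<Rightarrow> ('a, 'e) chart \<Rightarrow>
   'e \<Rightarrow> 'e \<Rightarrow> 'e \<Rightarrow> 'e" where
  "christoffel A g c x u v =
     (THE w. \<forall>z. 2 * form_rep A c g x w z =
        frechet_derivative (\<lambda>y. form_rep A c g y v z) (at x) u
        + frechet_derivative (\<lambda>y. form_rep A c g y u z) (at x) v
        - frechet_derivative (\<lambda>y. form_rep A c g y u v) (at x) z)"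

text \<open>\<open>\<nabla>df\<close> for a map \<open>f\<close> from \<open>(A, g)\<close> to \<open>(B, h)\<close>, where \<open>\<nabla>\<close> comes from the two Levi-Civita
  connections.\<close>

definition second_fundamental_form ::
  "('a, 'e::euclidean_space) chart set \<Rightarrow> ('a \<Rightarrow> 'e \<Rightarrow> 'e \<Rightarrow> real) \<Rightarrow>
   ('b, 'f::euclidean_space) chart set \<Rightarrow> ('b \<Rightarrow> 'f \<Rightarrow> 'f \<Rightarrow> real) \<Rightarrow>
   ('a \<Rightarrow> 'b) \<Rightarrow> 'a \<Rightarrow> 'e \<Rightarrow> 'e \<Rightarrow> 'f" where
  "second_fundamental_form A g B h f p u v =
     (let c = chart_at A p; d = chart_at B (f p); F = local_rep c d f; x = snd c p;
          DF = (\<lambda>y. frechet_derivative F (at y))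
      in frechet_derivative (\<lambda>y. DF y v) (at x) u
         + christoffel B h d (F x) (DF x u) (DF x v)
         - DF x (christoffel A g c x u v))"

definition orthonormal_basis_wrt :: "('e::euclidean_space \<Rightarrow> 'e \<Rightarrow> real) \<Rightarrow> 'e set \<Rightarrow> bool" where
  "orthonormal_basis_wrt b E \<longleftrightarrow> span E = UNIV \<and>
     (\<forall>u\<in>E. \<forall>v\<in>E. b u v = (if u = v then 1 else 0))"

text \<open>The trace of a bilinear map with respect to an inner product; it does not depend on the
  orthonormal basis.\<close>

definition trace_wrt ::
  "('e::euclidean_space \<Rightarrow> 'e \<Rightarrow> real) \<Rightarrow> ('e \<Rightarrow> 'e \<Rightarrow> 'f::euclidean_space) \<Rightarrow> 'f" where
  "trace_wrt b S = (\<Sum>u\<in>(SOME E. orthonormal_basis_wrt b E). S u u)"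

definition tension ::
  "('a, 'e::euclidean_space) chart set \<Rightarrow> ('a \<Rightarrow> 'e \<Rightarrow> 'e \<Rightarrow> real) \<Rightarrow>
   ('b, 'f::euclidean_space) chart set \<Rightarrow> ('b \<Rightarrow> 'f \<Rightarrow> 'f \<Rightarrow> real) \<Rightarrow> ('a \<Rightarrow> 'b) \<Rightarrow> 'a \<Rightarrow> 'f" where
  "tension A g B h f p = trace_wrt (g p) (second_fundamental_form A g B h f p)"

definition harmonic ::
  "('a::topological_space, 'e::euclidean_space) chart set \<Rightarrow> ('a \<Rightarrow> 'e \<Rightarrow> 'e \<Rightarrow> real) \<Rightarrow>
   ('b::topological_space, 'f::euclidean_space) chart set \<Rightarrow> ('b \<Rightarrow> 'f \<Rightarrow> 'f \<Rightarrow> real) \<Rightarrow>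
   ('a \<Rightarrow> 'b) \<Rightarrow> bool" where
  "harmonic A g B h f \<longleftrightarrow> smooth_map A B f \<and> (\<forall>p. tension A g B h f p = 0)"


section \<open>Lie groups\<close>

text \<open>Arguments: atlas, multiplication, neutral element, inverse.\<close>

definition connected_lie_group ::
  "('a::{t2_space, second_countable_topology}, 'e::euclidean_space) chart set \<Rightarrow>
   ('a \<Rightarrow> 'a \<Rightarrow> 'a) \<Rightarrow> 'a \<Rightarrow> ('a \<Rightarrow> 'a) \<Rightarrow> bool" where
  "connected_lie_group A mul e iv \<longleftrightarrow>
     group mul e iv \<and> smooth_atlas A \<and> connected (UNIV :: 'a set) \<and>
     smooth_map (prod_atlas A A) A (\<lambda>(a, b). mul a b) \<and> smooth_map A A iv"

definition left_invariant ::
  "('a, 'e::euclidean_space) chart set \<Rightarrow> ('a \<Rightarrow> 'a \<Rightarrow> 'a) \<Rightarrow> ('a \<Rightarrow> 'e \<Rightarrow> 'e \<Rightarrow> real) \<Rightarrow> bool" where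
  "left_invariant A mul h \<longleftrightarrow>
     (\<forall>a p u v. h (mul a p) (mdiff A A (mul a) p u) (mdiff A A (mul a) p v) = h p u v)"

text \<open>The Lie algebra is the tangent space at \<open>e\<close>, that is \<open>'e\<close>, with the bracket of left invariant
  vector fields.\<close>

definition left_invariant_field ::
  "('a, 'e::euclidean_space) chart set \<Rightarrow> ('a \<Rightarrow> 'a \<Rightarrow> 'a) \<Rightarrow> 'a \<Rightarrow> 'e \<Rightarrow> 'a \<Rightarrow> 'e" where
  "left_invariant_field A mul e u p = mdiff A A (mul p) e u"

definition ad ::
  "('a, 'e::euclidean_space) chart set \<Rightarrow> ('a \<Rightarrow> 'a \<Rightarrow> 'a) \<Rightarrow> 'a \<Rightarrow> 'e \<Rightarrow> 'e \<Rightarrow> 'e" where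
  "ad A mul e u v =
     field_bracket A (left_invariant_field A mul e u) (left_invariant_field A mul e v) e"

definition unimodular ::
  "('a, real ^ 'n) chart set \<Rightarrow> ('a \<Rightarrow> 'a \<Rightarrow> 'a) \<Rightarrow> 'a \<Rightarrow> bool" where
  "unimodular A mul e \<longleftrightarrow> (\<forall>u. trace (matrix (ad A mul e u)) = 0)"

text \<open>The library's \<open>adjoint\<close>, for an inner product other than the one of the type class.\<close>

definition adjoint_wrt ::
  "('e::euclidean_space \<Rightarrow> 'e \<Rightarrow> real) \<Rightarrow> ('e \<Rightarrow> 'e) \<Rightarrow> 'e \<Rightarrow> 'e" where
  "adjoint_wrt b f = (SOME f'. \<forall>x y. b (f x) y = b x (f' y))"

definition Kill ::
  "('a, 'e::euclidean_space) chart set \<Rightarrow> ('a \<Rightarrow> 'a \<Rightarrow> 'a) \<Rightarrow> 'a \<Rightarrow> ('a \<Rightarrow> 'e \<Rightarrow> 'e \<Rightarrow> real) \<Rightarrow>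
   'e set" where
  "Kill A mul e g = {u. ad A mul e u + adjoint_wrt (g e) (ad A mul e u) = 0}"

definition harmonic_cone ::
  "('a::topological_space, 'e::euclidean_space) chart set \<Rightarrow> ('a \<Rightarrow> 'a \<Rightarrow> 'a) \<Rightarrow>
   ('a \<Rightarrow> 'e \<Rightarrow> 'e \<Rightarrow> real) \<Rightarrow> ('a \<Rightarrow> 'e \<Rightarrow> 'e \<Rightarrow> real) set" where
  "harmonic_cone A mul g =
     {h. riemannian_metric A h \<and> left_invariant A mul h \<and> harmonic A g A h id}"

end

(*
  In a left invariant frame X_u the Koszul formula gives 2 h(nabla^h_u u, w) = 2 h([w, u], u). Summing over a
  g-orthonormal frame, unimodularity kills the contribution of the connection of g, so the identity
  is harmonic iff sum_i h([w, e_i], e_i) = 0 for all w. Writing h as a symmetric matrix M in a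
  g(e)-orthonormal basis and K(w)_ij = g(e_i, [w, e_j]), the condition reads <M, K(w)> = 0. The
  identity matrix satisfies it, so the positive definite solutions are open in the space of all
  symmetric solutions and span it. This space is the orthogonal complement, in the symmetric
  matrices, of the image of w |-> K(w) + K(w)^T, and the kernel of that map is Kill(g).
*)
theory Submission
  imports Defs
begin

section \<open>Calculus\<close>

text \<open>The dimension count is n(n+1)/2 - (n - dim Kill) = n(n-1)/2 + dim Kill, the rank of w
  |-> K(w) + K(w)^T being n - dim Kill. Unimodularity enters twice, both times as tr K(w) = tr ad_w
  = 0: once for the connection of g, and once to make the identity matrix, which stands for g
  itself, a solution. The obstacle is that tangent vectors are stored in a chart that varies with
  the point, so a vector field cannot be differentiated as it stands. Left invariant fields are
  therefore carried to a fixed chart (\<open>frame\<close>), where smoothness, the Koszul identity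
  and brackets are computed. Moreover \<open>ad\<close> is made of derivatives at \<open>e\<close>
  only, while the tension field has to vanish everywhere; \<open>frame_bracket\<close> carries the
  structure constants to every point, and for this it needs the symmetry of the second derivative of
  a left translation. The cone lives in an infinite-dimensional space of tensor fields. The
  injective linear map \<open>metric_of\<close> identifies it with a set of matrices without
  changing its dimension.\<close>

lemma Ck_on_cong:
  assumes "open S" "\<And>x. x \<in> S \<Longrightarrow> f x = g x"
  shows "Ck_on k S f \<longleftrightarrow> Ck_on k S g"
proof -
  \<comment> \<open>\<open>differentiable (at x)\<close> and \<open>frechet_derivative\<close>
    depend on the function in a neighbourhood of \<open>x\<close>, which openness of
    \<open>S\<close> provides. One implication for all pairs of functions is enough, as the
    hypothesis is symmetric.\<close>
  have "Ck_on k S f \<Longrightarrow> Ck_on k S g" if "\<And>x. x \<in> S \<Longrightarrow> f x = g x" for k and f g :: "'a \<Rightarrow> 'b"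
    using that
  proof (induction k arbitrary: f g)
    case 0
    then show ?case by (simp cong: continuous_on_cong)
  next
    case (Suc k)
    have D: "f differentiable at x" if "x \<in> S" for x using Suc.prems that by simp
    have "g differentiable at x" if "x \<in> S" for x
      using D[OF that] has_derivative_transform_within_open[of f _ x UNIV S g] assms(1) that Suc.prems(2)
      unfolding differentiable_def by blast
    moreover have "frechet_derivative f (at x) = frechet_derivative g (at x)" if "x \<in> S" for x
      using frechet_derivative_transform_within_open[OF D[OF that] assms(1) that Suc.prems(2)] .
    ultimately show ?case
      using Suc.prems(1) Suc.IH[of "\<lambda>x. frechet_derivative f (at x) v" "\<lambda>x. frechet_derivative g (at x) v" for v]
      by auto
  qed
  from this[of f g k] this[of g f k] assms(2) show ?thesis by auto
qed

lemma Ck_on_Suc: "Ck_on (Suc k) S f \<Longrightarrow> Ck_on k S f"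
proof (induction k arbitrary: f)
  case 0
  then show ?case
    by (auto intro!: continuous_at_imp_continuous_on differentiable_imp_continuous_within)
qed (metis Ck_on.simps(2))

lemma Ck_on_const: "Ck_on k S (\<lambda>x. c)"
proof (induction k arbitrary: c)
  case (Suc k)
  then show ?case by simp
qed auto

lemma frechet_derivativeI: "(f has_derivative f') (at x) \<Longrightarrow> frechet_derivative f (at x) = f'"
  by (metis frechet_derivative_at)

lemma Ck_on_add:
  assumes "open S" "Ck_on k S f" "Ck_on k S g"
  shows "Ck_on k S (\<lambda>x. f x + g x)"
  using assms(2,3)
proof (induction k arbitrary: f g)
  case (Suc k)
  have "frechet_derivative (\<lambda>x. f x + g x) (at x) =
      (\<lambda>v. frechet_derivative f (at x) v + frechet_derivative g (at x) v)" if "x \<in> S" for x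
    using Suc.prems that
    by (intro frechet_derivativeI has_derivative_add) (auto simp: frechet_derivative_works[symmetric])
  then have "Ck_on k S (\<lambda>x. frechet_derivative (\<lambda>x. f x + g x) (at x) v)" for v
    using Suc.prems
    by (subst Ck_on_cong[OF assms(1), where g = "\<lambda>x. frechet_derivative f (at x) v + frechet_derivative g (at x) v"])
       (auto intro!: Suc.IH)
  then show ?case
    using Suc.prems by (auto intro!: differentiable_add)
qed (auto intro: continuous_on_add)

lemma Ck_on_sum:
  assumes "open S" "\<And>i. i \<in> I \<Longrightarrow> Ck_on k S (f i)"
  shows "Ck_on k S (\<lambda>x. \<Sum>i\<in>I. f i x)"
  using assms(2)
  by (induction I rule: infinite_finite_induct) (auto intro!: Ck_on_const Ck_on_add assms(1))

lemma Ck_on_mult: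
  fixes f g :: "'a::real_normed_vector \<Rightarrow> real"
  assumes "open S" "Ck_on k S f" "Ck_on k S g"
  shows "Ck_on k S (\<lambda>x. f x * g x)"
  using assms(2,3)
proof (induction k arbitrary: f g)
  case (Suc k)
  have "frechet_derivative (\<lambda>x. f x * g x) (at x) =
      (\<lambda>v. f x * frechet_derivative g (at x) v + frechet_derivative f (at x) v * g x)" if "x \<in> S" for x
    using Suc.prems that
    by (intro frechet_derivativeI has_derivative_mult) (auto simp: frechet_derivative_works[symmetric])
  \<comment> \<open>The product rule keeps one factor undifferentiated; \<open>Ck_on_Suc\<close>
    lowers its order to \<open>k\<close> to meet the induction hypothesis.\<close>
  moreover have "Ck_on k S (\<lambda>x. f x * frechet_derivative g (at x) v + frechet_derivative f (at x) v * g x)" for v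
    using Suc.prems Ck_on_Suc[of k S f] Ck_on_Suc[of k S g]
    by (intro Ck_on_add Suc.IH assms(1)) auto
  ultimately have "Ck_on k S (\<lambda>x. frechet_derivative (\<lambda>x. f x * g x) (at x) v)" for v
    by (subst Ck_on_cong[OF assms(1), where g = "\<lambda>x. f x * frechet_derivative g (at x) v + frechet_derivative f (at x) v * g x"])
       auto
  then show ?case
    using Suc.prems by (auto intro!: differentiable_mult)
qed (auto intro: continuous_on_mult)

lemma Ck_on_bounded_linear:
  assumes "open S" "bounded_linear L" "Ck_on k S f"
  shows "Ck_on k S (\<lambda>x. L (f x))"
  using assms(3)
proof (induction k arbitrary: f)
  case 0
  then show ?case using assms(2) by (auto intro: bounded_linear.continuous_on)
next
  case (Suc k)
  have D: "((\<lambda>x. L (f x)) has_derivative (\<lambda>v. L (frechet_derivative f (at x) v))) (at x)" if "x \<in> S" for x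
    using Suc.prems that
    by (intro bounded_linear.has_derivative[OF assms(2)]) (auto simp: frechet_derivative_works[symmetric])
  have "Ck_on k S (\<lambda>x. frechet_derivative (\<lambda>x. L (f x)) (at x) v)" for v
    using Suc.prems D[THEN frechet_derivativeI]
    by (subst Ck_on_cong[OF assms(1), where g = "\<lambda>x. L (frechet_derivative f (at x) v)"])
       (auto intro!: Suc.IH)
  then show ?case
    using D by (auto simp: differentiable_def)
qed

text \<open>Affine substitutions suffice to freeze one argument of the group multiplication in
  charts. They avoid the chain rule for higher derivatives: the direction \<open>v\<close> merely
  becomes \<open>L v\<close>.\<close>

lemma Ck_on_affine_compose:
  assumes "open S" "open T" "bounded_linear L" "\<And>y. y \<in> T \<Longrightarrow> a + L y \<in> S" "Ck_on k S f"
  shows "Ck_on k T (\<lambda>y. f (a + L y))"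
  using assms(5)
proof (induction k arbitrary: f)
  case 0
  then show ?case
    using assms(4) by (auto intro!: continuous_on_compose2[of S f] continuous_intros
        bounded_linear.continuous_on[OF assms(3)])
next
  case (Suc k)
  have D: "((\<lambda>y. f (a + L y)) has_derivative (\<lambda>v. frechet_derivative f (at (a + L y)) (L v))) (at y)"
    if "y \<in> T" for y
  proof -
    have 1: "((\<lambda>y. a + L y) has_derivative L) (at y)"
      using bounded_linear_imp_has_derivative[OF assms(3)] by (auto intro!: derivative_eq_intros)
    have 2: "(f has_derivative frechet_derivative f (at (a + L y))) (at (a + L y))"
      using Suc.prems assms(4)[OF that] by (simp add: frechet_derivative_works[symmetric])
    show ?thesis using diff_chain_at[OF 1 2] by (simp add: o_def)
  qed
  have "Ck_on k T (\<lambda>y. frechet_derivative (\<lambda>y. f (a + L y)) (at y) v)" for v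
    using Suc.prems D[THEN frechet_derivativeI]
      Suc.IH[of "\<lambda>x. frechet_derivative f (at x) (L v)"]
    by (subst Ck_on_cong[OF assms(2), where g = "\<lambda>y. frechet_derivative f (at (a + L y)) (L v)"]) auto
  then show ?case
    using D by (auto simp: differentiable_def)
qed

lemma smooth_on_sum:
  "open S \<Longrightarrow> (\<And>i. i \<in> I \<Longrightarrow> smooth_on S (f i)) \<Longrightarrow> smooth_on S (\<lambda>x. \<Sum>i\<in>I. f i x)"
  by (simp add: smooth_on_def Ck_on_sum)

lemma smooth_on_mult:
  fixes f g :: "'a::real_normed_vector \<Rightarrow> real"
  shows "open S \<Longrightarrow> smooth_on S f \<Longrightarrow> smooth_on S g \<Longrightarrow> smooth_on S (\<lambda>x. f x * g x)"
  by (simp add: smooth_on_def Ck_on_mult)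

lemma smooth_on_const: "smooth_on S (\<lambda>x. c)"
  by (simp add: smooth_on_def Ck_on_const)

lemma smooth_on_bounded_linear:
  "open S \<Longrightarrow> bounded_linear L \<Longrightarrow> smooth_on S f \<Longrightarrow> smooth_on S (\<lambda>x. L (f x))"
  by (simp add: smooth_on_def Ck_on_bounded_linear)

lemma smooth_on_cong:
  "open S \<Longrightarrow> (\<And>x. x \<in> S \<Longrightarrow> f x = g x) \<Longrightarrow> smooth_on S f \<longleftrightarrow> smooth_on S g"
  using Ck_on_cong[of S f g] by (auto simp: smooth_on_def)

lemma smooth_on_affine_compose:
  assumes "open S" "open T" "bounded_linear L" "\<And>y. y \<in> T \<Longrightarrow> a + L y \<in> S" "smooth_on S f"
  shows "smooth_on T (\<lambda>y. f (a + L y))"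
  using assms by (auto simp: smooth_on_def intro: Ck_on_affine_compose)

lemma smooth_on_frechet_derivative:
  "smooth_on S f \<Longrightarrow> smooth_on S (\<lambda>x. frechet_derivative f (at x) v)"
  unfolding smooth_on_def by (metis Ck_on.simps(2))

lemma smooth_on_has_derivative:
  "smooth_on S f \<Longrightarrow> x \<in> S \<Longrightarrow> (f has_derivative frechet_derivative f (at x)) (at x)"
  unfolding smooth_on_def by (metis Ck_on.simps(2) frechet_derivative_works)

section \<open>Symmetry of second derivatives\<close>

lemma second_difference_mean_value:
  fixes f :: "'a::real_normed_vector \<Rightarrow> real"
  assumes t: "t > 0"
    and inS: "\<And>a b. 0 \<le> a \<Longrightarrow> a \<le> t \<Longrightarrow> 0 \<le> b \<Longrightarrow> b \<le> t \<Longrightarrow> x + a *\<^sub>R u + b *\<^sub>R v \<in> S"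
    and D1: "\<And>y. y \<in> S \<Longrightarrow> (f has_derivative D y) (at y)"
    and D2: "\<And>y. y \<in> S \<Longrightarrow> ((\<lambda>z. D z u) has_derivative D' y) (at y)"
  shows "\<exists>a b. 0 \<le> a \<and> a \<le> t \<and> 0 \<le> b \<and> b \<le> t \<and>
    f (x + t *\<^sub>R u + t *\<^sub>R v) - f (x + t *\<^sub>R u) - f (x + t *\<^sub>R v) + f x =
    t * t * D' (x + a *\<^sub>R u + b *\<^sub>R v) v"
proof -
  \<comment> \<open>\<open>\<phi>\<close> is the first difference in direction \<open>v\<close>. The
    mean value theorem in direction \<open>u\<close> turns its increment into a difference of
    \<open>\<lambda>y. D y u\<close> along \<open>v\<close>, and a second application, to
    \<open>\<psi>\<close>, finishes.\<close>
  define \<phi> where "\<phi> s = f (x + s *\<^sub>R u + t *\<^sub>R v) - f (x + s *\<^sub>R u)" for s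
  have inS0: "x + s *\<^sub>R u \<in> S" if "0 \<le> s" "s \<le> t" for s
    using inS[of s 0] that t by simp
  have d\<phi>: "(\<phi> has_derivative (\<lambda>h. D (x + s *\<^sub>R u + t *\<^sub>R v) (h *\<^sub>R u) - D (x + s *\<^sub>R u) (h *\<^sub>R u))) (at s)"
    if "0 \<le> s" "s \<le> t" for s
    unfolding \<phi>_def
    by (rule has_derivative_diff; rule has_derivative_compose[OF _ D1])
       (use that inS inS0 t in \<open>auto intro!: derivative_eq_intros\<close>)
  obtain a where a: "0 < a" "a < t"
    "\<phi> t - \<phi> 0 = D (x + a *\<^sub>R u + t *\<^sub>R v) ((t - 0) *\<^sub>R u) - D (x + a *\<^sub>R u) ((t - 0) *\<^sub>R u)"
  proof -
    have "\<exists>\<xi>\<in>{0<..<t}. \<phi> t - \<phi> 0 =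
      (\<lambda>h. D (x + \<xi> *\<^sub>R u + t *\<^sub>R v) (h *\<^sub>R u) - D (x + \<xi> *\<^sub>R u) (h *\<^sub>R u)) (t - 0)"
      by (rule mvt_simple[OF t, where f = \<phi> and f' = "\<lambda>s h. D (x + s *\<^sub>R u + t *\<^sub>R v) (h *\<^sub>R u) - D (x + s *\<^sub>R u) (h *\<^sub>R u)"])
        (rule has_derivative_at_withinI, rule d\<phi>, auto)
    then show ?thesis using that by auto
  qed
  have lin: "D y (c *\<^sub>R w) = c * D y w" if "y \<in> S" for y c w
    using linear_scale[OF has_derivative_linear[OF D1[OF that]], of c w] unfolding real_scaleR_def .
  define \<psi> where "\<psi> s = D (x + a *\<^sub>R u + s *\<^sub>R v) u" for s
  have d\<psi>: "(\<psi> has_derivative (\<lambda>h. D' (x + a *\<^sub>R u + s *\<^sub>R v) (h *\<^sub>R v))) (at s)"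
    if "0 \<le> s" "s \<le> t" for s
    unfolding \<psi>_def
    by (rule has_derivative_compose[OF _ D2])
       (use that inS a in \<open>auto intro!: derivative_eq_intros\<close>)
  obtain b where b: "0 < b" "b < t"
    "\<psi> t - \<psi> 0 = D' (x + a *\<^sub>R u + b *\<^sub>R v) ((t - 0) *\<^sub>R v)"
  proof -
    have "\<exists>\<xi>\<in>{0<..<t}. \<psi> t - \<psi> 0 = (\<lambda>h. D' (x + a *\<^sub>R u + \<xi> *\<^sub>R v) (h *\<^sub>R v)) (t - 0)"
      by (rule mvt_simple[OF t, where f = \<psi> and f' = "\<lambda>s h. D' (x + a *\<^sub>R u + s *\<^sub>R v) (h *\<^sub>R v)"])
        (rule has_derivative_at_withinI, rule d\<psi>, auto)
    then show ?thesis using that by auto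
  qed
  have "D' (x + a *\<^sub>R u + b *\<^sub>R v) (t *\<^sub>R v) = t * D' (x + a *\<^sub>R u + b *\<^sub>R v) v"
    using linear_scale[OF has_derivative_linear[OF D2[OF inS]], of a b t v] a b unfolding real_scaleR_def
    by (meson less_imp_le)
  then have "\<phi> t - \<phi> 0 = t * t * D' (x + a *\<^sub>R u + b *\<^sub>R v) v"
    using a b inS[of a t] inS0[of a] t by (simp add: lin \<psi>_def algebra_simps)
  then show ?thesis
    using a b unfolding \<phi>_def by (intro exI[of _ a] exI[of _ b]) (auto simp: algebra_simps)
qed

text \<open>The second difference over a small parallelogram is symmetric in \<open>u\<close> and
  \<open>v\<close>. The mean value theorem expresses it through either mixed derivative at a nearby
  point, and continuity brings both points to \<open>x\<close>.\<close>

lemma symmetric_second_derivative_real: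
  fixes f :: "'a::real_normed_vector \<Rightarrow> real"
  assumes S: "open S" "x \<in> S" and C: "Ck_on 2 S f"
  shows "frechet_derivative (\<lambda>y. frechet_derivative f (at y) u) (at x) v =
    frechet_derivative (\<lambda>y. frechet_derivative f (at y) v) (at x) u" (is "?D u x v = ?D v x u")
proof (rule ccontr)
  assume ne: "?D u x v \<noteq> ?D v x u"
  have C': "Ck_on (Suc (Suc 0)) S f" using C by (simp add: numeral_2_eq_2)
  have D1: "(f has_derivative frechet_derivative f (at y)) (at y)" if "y \<in> S" for y
    using C' that by (simp add: frechet_derivative_works[symmetric])
  have D2: "((\<lambda>z. frechet_derivative f (at z) w) has_derivative ?D w y) (at y)" if "y \<in> S" for y w
    using C' that by (simp add: frechet_derivative_works[symmetric])
  have cont: "continuous_on S (\<lambda>y. ?D w y w')" for w w'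
    using C' by simp
  \<comment> \<open>Half the gap: two numbers closer than \<open>\<epsilon>\<close> to the
    respective mixed derivatives cannot coincide.\<close>
  define \<epsilon> where "\<epsilon> = \<bar>?D u x v - ?D v x u\<bar> / 2"
  have \<epsilon>: "\<epsilon> > 0" using ne by (simp add: \<epsilon>_def)
  obtain d0 where d0: "d0 > 0" "ball x d0 \<subseteq> S" using S openE by blast
  obtain d1 where d1: "d1 > 0" "\<And>y. y \<in> S \<Longrightarrow> dist y x < d1 \<Longrightarrow> dist (?D u y v) (?D u x v) < \<epsilon>"
    using cont[of u v] S(2) \<epsilon> unfolding continuous_on_iff by metis
  obtain d2 where d2: "d2 > 0" "\<And>y. y \<in> S \<Longrightarrow> dist y x < d2 \<Longrightarrow> dist (?D v y u) (?D v x u) < \<epsilon>"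
    using cont[of v u] S(2) \<epsilon> unfolding continuous_on_iff by metis
  define d where "d = min d0 (min d1 d2)"
  \<comment> \<open>The parallelogram with sides \<open>t *\<^sub>R u\<close> and
    \<open>t *\<^sub>R v\<close> stays within distance \<open>d / 2\<close> of \<open>x\<close>; the
    summand 1 keeps the denominator positive when both vectors vanish.\<close>
  define t where "t = d / 2 / (norm u + norm v + 1)"
  have d: "d > 0" "d \<le> d0" "d \<le> d1" "d \<le> d2" using d0 d1 d2 by (auto simp: d_def)
  have t: "t > 0" using d by (auto simp: t_def intro!: divide_pos_pos add_nonneg_pos)
  have near: "dist (x + a *\<^sub>R u + b *\<^sub>R v) x < d" if "0 \<le> a" "a \<le> t" "0 \<le> b" "b \<le> t" for a b
  proof -
    have "dist (x + a *\<^sub>R u + b *\<^sub>R v) x \<le> a * norm u + b * norm v"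
      using norm_triangle_ineq[of "a *\<^sub>R u" "b *\<^sub>R v"] that by (simp add: dist_norm algebra_simps)
    also have "\<dots> \<le> t * norm u + t * norm v" using that by (intro add_mono mult_right_mono) auto
    also have "\<dots> \<le> t * (norm u + norm v + 1)" using t by (simp add: algebra_simps)
    also have "\<dots> = d / 2"
      unfolding t_def using norm_ge_zero[of u] norm_ge_zero[of v] by (simp add: add_nonneg_eq_0_iff field_simps)
    finally show ?thesis using d by simp
  qed
  have inS: "x + a *\<^sub>R u + b *\<^sub>R v \<in> S" if "0 \<le> a" "a \<le> t" "0 \<le> b" "b \<le> t" for a b
    using near[OF that] d0 d by (auto simp: dist_commute subset_eq)
  have inS': "x + a *\<^sub>R v + b *\<^sub>R u \<in> S" if "0 \<le> a" "a \<le> t" "0 \<le> b" "b \<le> t" for a b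
    using inS[of b a] that by (simp add: algebra_simps)
  obtain a b where ab: "0 \<le> a" "a \<le> t" "0 \<le> b" "b \<le> t"
    "f (x + t *\<^sub>R u + t *\<^sub>R v) - f (x + t *\<^sub>R u) - f (x + t *\<^sub>R v) + f x = t * t * ?D u (x + a *\<^sub>R u + b *\<^sub>R v) v"
    using second_difference_mean_value[OF t inS D1 D2] by blast
  obtain a' b' where ab': "0 \<le> a'" "a' \<le> t" "0 \<le> b'" "b' \<le> t"
    "f (x + t *\<^sub>R v + t *\<^sub>R u) - f (x + t *\<^sub>R v) - f (x + t *\<^sub>R u) + f x = t * t * ?D v (x + a' *\<^sub>R v + b' *\<^sub>R u) u"
    using second_difference_mean_value[OF t inS' D1 D2] by blast
  have sw: "x + t *\<^sub>R v + t *\<^sub>R u = x + t *\<^sub>R u + t *\<^sub>R v" "x + a' *\<^sub>R v + b' *\<^sub>R u = x + b' *\<^sub>R u + a' *\<^sub>R v"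
    by simp_all
  from ab(5) ab'(5) have "t * t * ?D u (x + a *\<^sub>R u + b *\<^sub>R v) v = t * t * ?D v (x + b' *\<^sub>R u + a' *\<^sub>R v) u"
    unfolding sw by linarith
  then have eq: "?D u (x + a *\<^sub>R u + b *\<^sub>R v) v = ?D v (x + b' *\<^sub>R u + a' *\<^sub>R v) u" using t by simp
  have 1: "dist (?D u (x + a *\<^sub>R u + b *\<^sub>R v) v) (?D u x v) < \<epsilon>"
    using d1(2)[OF inS near[THEN order_less_le_trans]] ab d by auto
  have 2: "dist (?D v (x + b' *\<^sub>R u + a' *\<^sub>R v) u) (?D v x u) < \<epsilon>"
    using d2(2)[OF inS near[THEN order_less_le_trans]] ab' d by auto
  from 1 2 eq show False unfolding \<epsilon>_def dist_real_def by argo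
qed

lemma symmetric_second_derivative:
  fixes f :: "'a::real_normed_vector \<Rightarrow> 'b::euclidean_space"
  assumes S: "open S" "x \<in> S" and C: "Ck_on 2 S f"
  shows "frechet_derivative (\<lambda>y. frechet_derivative f (at y) u) (at x) v =
    frechet_derivative (\<lambda>y. frechet_derivative f (at y) v) (at x) u"
proof (rule euclidean_eqI)
  fix b :: 'b
  assume "b \<in> Basis"
  have C': "Ck_on (Suc (Suc 0)) S f" using C by (simp add: numeral_2_eq_2)
  have bl: "bounded_linear (\<lambda>z. z \<bullet> b)" by (rule bounded_linear_inner_left)
  have D1: "frechet_derivative (\<lambda>z. f z \<bullet> b) (at y) = (\<lambda>w. frechet_derivative f (at y) w \<bullet> b)" if "y \<in> S" for y
    using C' that
    by (intro frechet_derivativeI bounded_linear.has_derivative[OF bl]) (auto simp: frechet_derivative_works[symmetric])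
  have D2: "((\<lambda>y. frechet_derivative (\<lambda>z. f z \<bullet> b) (at y) w) has_derivative
      (\<lambda>w'. frechet_derivative (\<lambda>y. frechet_derivative f (at y) w) (at x) w' \<bullet> b)) (at x)" for w
    by (rule has_derivative_transform_within_open
        [OF bounded_linear.has_derivative[OF bl, of "\<lambda>y. frechet_derivative f (at y) w"] S])
       (use C' S D1 in \<open>auto simp: frechet_derivative_works[symmetric]\<close>)
  show "frechet_derivative (\<lambda>y. frechet_derivative f (at y) u) (at x) v \<bullet> b =
    frechet_derivative (\<lambda>y. frechet_derivative f (at y) v) (at x) u \<bullet> b"
    using symmetric_second_derivative_real[OF S Ck_on_bounded_linear[OF S(1) bl C], of u v]
    by (simp add: D2[THEN frechet_derivativeI])
qed


section \<open>Leibniz rules for point-dependent linear and bilinear maps\<close>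

lemma linear_expansion:
  fixes f :: "'e::euclidean_space \<Rightarrow> 'b::real_vector"
  assumes "linear f"
  shows "f v = (\<Sum>i\<in>Basis. (v \<bullet> i) *\<^sub>R f i)"
proof -
  have "f v = f (\<Sum>i\<in>Basis. (v \<bullet> i) *\<^sub>R i)" by (simp add: euclidean_representation)
  also have "\<dots> = (\<Sum>i\<in>Basis. (v \<bullet> i) *\<^sub>R f i)"
    using assms by (simp add: linear_sum linear_scale)
  finally show ?thesis .
qed

lemma bilinear_real_simps:
  fixes b :: "'e::real_vector \<Rightarrow> 'f::real_vector \<Rightarrow> real"
  assumes "bilinear b"
  shows "b (x + y) z = b x z + b y z" "b z' (u + v) = b z' u + b z' v"
    "b (x - y) z = b x z - b y z" "b z' (u - v) = b z' u - b z' v"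
    "b (c *\<^sub>R x) z = c * b x z" "b z' (c *\<^sub>R u) = c * b z' u"
    "b 0 z = 0" "b z' 0 = 0"
    "b (sum f I) z = (\<Sum>i\<in>I. b (f i) z)" "b z' (sum f' I) = (\<Sum>i\<in>I. b z' (f' i))"
proof -
  have l: "linear (\<lambda>x. b x z)" "linear (b z')" using assms by (auto simp: bilinear_def)
  show "b (sum f I) z = (\<Sum>i\<in>I. b (f i) z)" "b z' (sum f' I) = (\<Sum>i\<in>I. b z' (f' i))"
    using linear_sum[OF l(1)] linear_sum[OF l(2)] by auto
qed (simp_all add: bilinear_ladd[OF assms] bilinear_radd[OF assms] bilinear_lsub[OF assms] bilinear_rsub[OF assms]
    bilinear_lmul[OF assms] bilinear_rmul[OF assms] bilinear_lzero[OF assms] bilinear_rzero[OF assms])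

text \<open>Each \<open>B y\<close> is determined by its values on \<open>Basis\<close>, so
  differentiating the finite expansion passes linearity in \<open>v\<close> on to the
  derivative.\<close>

lemma frechet_derivative_linear_family:
  fixes B :: "'a::real_normed_vector \<Rightarrow> 'e::euclidean_space \<Rightarrow> 'b::real_normed_vector"
  assumes S: "open S" "x \<in> S" and lin: "\<And>y. y \<in> S \<Longrightarrow> linear (B y)"
    and B': "\<And>v. ((\<lambda>y. B y v) has_derivative B' v) (at x)"
  shows "B' v w = (\<Sum>i\<in>Basis. (v \<bullet> i) *\<^sub>R B' i w)"
proof -
  have "((\<lambda>y. \<Sum>i\<in>Basis. (v \<bullet> i) *\<^sub>R B y i) has_derivative (\<lambda>w. \<Sum>i\<in>Basis. (v \<bullet> i) *\<^sub>R B' i w)) (at x)"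
    by (intro has_derivative_sum has_derivative_scaleR_right B')
  then have "((\<lambda>y. B y v) has_derivative (\<lambda>w. \<Sum>i\<in>Basis. (v \<bullet> i) *\<^sub>R B' i w)) (at x)"
    by (rule has_derivative_transform_within_open[OF _ S])
      (simp add: linear_expansion[OF lin, symmetric])
  from has_derivative_unique[OF this B'] show ?thesis by metis
qed

lemma linear_frechet_derivative_family:
  fixes B :: "'a::real_normed_vector \<Rightarrow> 'e::euclidean_space \<Rightarrow> 'b::real_normed_vector"
  assumes "open S" "x \<in> S" "\<And>y. y \<in> S \<Longrightarrow> linear (B y)"
    and "\<And>v. ((\<lambda>y. B y v) has_derivative B' v) (at x)"
  shows "linear (\<lambda>v. B' v w)"
proof -
  have "(\<lambda>v. B' v w) = (\<lambda>v. \<Sum>i\<in>Basis. (v \<bullet> i) *\<^sub>R B' i w)"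
    by (rule ext, rule frechet_derivative_linear_family[OF assms])
  moreover have "linear (\<lambda>v. \<Sum>i\<in>Basis. (v \<bullet> i) *\<^sub>R k i)" for k :: "'e \<Rightarrow> 'b"
    by (rule linearI) (simp_all add: inner_add_left scaleR_add_left sum.distrib scaleR_sum_right)
  ultimately show ?thesis by (simp only:)
qed

text \<open>Differentiability is assumed for each fixed vector, not in operator norm. In finite
  dimension this is enough: expanding \<open>X y\<close> in \<open>Basis\<close> reduces the claim
  to products of scalar and vector functions.\<close>

lemma has_derivative_linear_family:
  fixes B :: "'a::real_normed_vector \<Rightarrow> 'e::euclidean_space \<Rightarrow> 'b::real_normed_vector"
  assumes S: "open S" "x \<in> S" and lin: "\<And>y. y \<in> S \<Longrightarrow> linear (B y)"
    and B': "\<And>v. ((\<lambda>y. B y v) has_derivative B' v) (at x)"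
    and X: "(X has_derivative X') (at x)"
  shows "((\<lambda>y. B y (X y)) has_derivative (\<lambda>w. B' (X x) w + B x (X' w))) (at x)"
proof -
  have exp: "B y v = (\<Sum>i\<in>Basis. (v \<bullet> i) *\<^sub>R B y i)" if "y \<in> S" for y v
    using linear_expansion[OF lin[OF that]] .
  have "((\<lambda>y. \<Sum>i\<in>Basis. (X y \<bullet> i) *\<^sub>R B y i) has_derivative
      (\<lambda>w. \<Sum>i\<in>Basis. (X x \<bullet> i) *\<^sub>R B' i w + (X' w \<bullet> i) *\<^sub>R B x i)) (at x)"
    by (intro has_derivative_sum has_derivative_scaleR B' has_derivative_inner_left X)
  then have "((\<lambda>y. B y (X y)) has_derivative
      (\<lambda>w. \<Sum>i\<in>Basis. (X x \<bullet> i) *\<^sub>R B' i w + (X' w \<bullet> i) *\<^sub>R B x i)) (at x)"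
    by (rule has_derivative_transform_within_open[OF _ S]) (use exp in metis)
  moreover have "(\<Sum>i\<in>Basis. (X x \<bullet> i) *\<^sub>R B' i w + (X' w \<bullet> i) *\<^sub>R B x i) = B' (X x) w + B x (X' w)" for w
    using frechet_derivative_linear_family[OF S lin B', of "X x" w] exp[OF S(2), of "X' w"]
    by (simp add: sum.distrib)
  ultimately show ?thesis by simp
qed

lemma has_derivative_bilinear_family:
  fixes G :: "'a::real_normed_vector \<Rightarrow> 'e::euclidean_space \<Rightarrow> 'f::euclidean_space \<Rightarrow> 'b::real_normed_vector"
  assumes S: "open S" "x \<in> S" and bil: "\<And>y. y \<in> S \<Longrightarrow> bilinear (G y)"
    and G': "\<And>u v. ((\<lambda>y. G y u v) has_derivative G' u v) (at x)"
    and X: "(X has_derivative X') (at x)" and Y: "(Y has_derivative Y') (at x)"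
  shows "((\<lambda>y. G y (X y) (Y y)) has_derivative
    (\<lambda>w. G' (X x) (Y x) w + G x (X x) (Y' w) + G x (X' w) (Y x))) (at x)"
proof -
  have 1: "((\<lambda>y. G y u (Y y)) has_derivative (\<lambda>w. G' u (Y x) w + G x u (Y' w))) (at x)" for u
    by (rule has_derivative_linear_family[OF S _ G' Y]) (use bil in \<open>auto simp: bilinear_def\<close>)
  show ?thesis
    using has_derivative_linear_family[where B = "\<lambda>y v. G y v (Y y)", OF S _ 1 X] bil
    by (simp add: bilinear_def add.assoc)
qed


section \<open>Inner products on a Euclidean space\<close>

text \<open>The algebraic part of \<open>riemannian_metric\<close> at a single point. It applies
  alike to \<open>g p\<close> and to the representation of a metric in a chart.\<close>

definition inner_form :: "('e::euclidean_space \<Rightarrow> 'e \<Rightarrow> real) \<Rightarrow> bool" where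
  "inner_form b \<longleftrightarrow> bilinear b \<and> (\<forall>u v. b u v = b v u) \<and> (\<forall>u. u \<noteq> 0 \<longrightarrow> 0 < b u u)"

lemma inner_form_linear:
  assumes "inner_form b"
  shows "linear (b u)" "linear (\<lambda>u. b u v)"
  using assms by (auto simp: inner_form_def bilinear_def)

lemma inner_form_simps:
  assumes "inner_form b"
  shows "b (x + y) z = b x z + b y z" "b z (x + y) = b z x + b z y"
    "b (x - y) z = b x z - b y z" "b z (x - y) = b z x - b z y"
    "b (c *\<^sub>R x) z = c * b x z" "b z (c *\<^sub>R x) = c * b z x"
    "b 0 z = 0" "b z 0 = 0"
    "b (sum f I) z = (\<Sum>i\<in>I. b (f i) z)" "b z (sum f I) = (\<Sum>i\<in>I. b z (f i))"
  by (rule bilinear_real_simps, use assms in \<open>simp add: inner_form_def\<close>)+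

lemma inner_form_sym: "inner_form b \<Longrightarrow> b u v = b v u"
  by (simp add: inner_form_def)

lemma inner_form_pos: "inner_form b \<Longrightarrow> u \<noteq> 0 \<Longrightarrow> 0 < b u u"
  by (simp add: inner_form_def)

lemma inner_form_eqI:
  assumes b: "inner_form b" and "\<And>z. b u z = b v z"
  shows "u = v"
proof -
  have "b (u - v) (u - v) = 0"
    using assms(2)[of "u - v"] by (simp add: inner_form_simps(3)[OF b])
  then show ?thesis using inner_form_pos[OF b, of "u - v"] by auto
qed

text \<open>\<open>T w\<close> lists the products of \<open>w\<close> with the standard basis.
  Positivity makes \<open>T\<close> injective, hence surjective, and a preimage of the vector of
  values of \<open>f\<close> on the basis represents \<open>f\<close>.\<close>

lemma inner_form_riesz:
  assumes b: "inner_form b" and f: "linear f"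
  obtains w where "\<And>z. b w z = f z"
proof -
  define T where "T w = (\<Sum>i\<in>Basis. b w i *\<^sub>R i)" for w
  have lin: "linear T"
    unfolding T_def
    by (intro linear_compose_sum) (auto intro!: linearI simp: algebra_simps
        inner_form_simps[OF b])
  have Ti: "T w \<bullet> i = b w i" if "i \<in> Basis" for w i
    unfolding T_def using that by (simp add: inner_sum_left inner_Basis if_distrib cong: if_cong)
  have "inj T"
  proof (rule linear_injective_0[OF lin, THEN iffD2], intro allI impI)
    fix w assume "T w = 0"
    then have "b w i = 0" if "i \<in> Basis" for i using Ti[OF that, of w] by simp
    then have "b w w = 0" using linear_expansion[OF inner_form_linear(1)[OF b], of w w] by simp
    then show "w = 0" using inner_form_pos[OF b] by force
  qed
  then have "surj T" using linear_injective_imp_surjective[OF lin] by simp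
  then obtain w where w: "(\<Sum>i\<in>Basis. f i *\<^sub>R i) = T w" by (meson surjD)
  have "b w i = f i" if "i \<in> Basis" for i
    using Ti[OF that, of w] that
    by (simp add: w[symmetric] inner_sum_left inner_Basis if_distrib cong: if_cong)
  then have "b w z = f z" for z
    using linear_expansion[OF inner_form_linear(1)[OF b], of w z] linear_expansion[OF f, of z] by simp
  then show ?thesis using that by blast
qed

section \<open>Orthonormal bases, traces and adjoints\<close>

lemma orthonormal_expansion_in_span:
  assumes b: "inner_form b" and on: "\<forall>u\<in>E. \<forall>v\<in>E. b u v = (if u = v then 1 else 0)"
    and fin: "finite E"
  shows "x \<in> span E \<Longrightarrow> x = (\<Sum>u\<in>E. b x u *\<^sub>R u)"
proof (induction rule: span_induct_alt)
  case base
  then show ?case by (simp add: inner_form_simps[OF b])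
next
  case (step c x y)
  have "(\<Sum>u\<in>E. b (c *\<^sub>R x + y) u *\<^sub>R u) = (\<Sum>u\<in>E. (c * b x u) *\<^sub>R u) + (\<Sum>u\<in>E. b y u *\<^sub>R u)"
    by (simp add: inner_form_simps[OF b] scaleR_add_left sum.distrib)
  also have "(\<Sum>u\<in>E. (c * b x u) *\<^sub>R u) = (\<Sum>u\<in>E. if x = u then c *\<^sub>R u else 0)"
    using on step.hyps by (intro sum.cong) auto
  also have "\<dots> = c *\<^sub>R x" using fin step.hyps by simp
  finally show ?case using step.IH by simp
qed

lemma orthonormal_independent:
  assumes b: "inner_form b" and on: "\<forall>u\<in>E. \<forall>v\<in>E. b u v = (if u = v then 1 else 0)"
  shows "independent E" "finite E"
proof -
  show "independent E"
  proof
    assume "dependent E"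
    then obtain t c where t: "finite t" "t \<subseteq> E" "(\<Sum>v\<in>t. c v *\<^sub>R v) = 0" and "\<exists>v\<in>t. c v \<noteq> 0"
      unfolding dependent_explicit by blast
    then obtain v where v: "v \<in> t" "c v \<noteq> 0" by blast
    have "0 = b (\<Sum>v\<in>t. c v *\<^sub>R v) v" using t by (simp add: inner_form_simps[OF b])
    also have "\<dots> = (\<Sum>u\<in>t. c u * b u v)"
      by (simp add: inner_form_simps[OF b])
    also have "\<dots> = (\<Sum>u\<in>t. if v = u then c u else 0)"
      using on t v by (intro sum.cong) (auto simp: subset_eq)
    also have "\<dots> = c v" using t v by simp
    finally show False using v by simp
  qed
  then show "finite E" by (rule independent_imp_finite)
qed

lemma orthonormal_basis_expansion:
  assumes "inner_form b" "orthonormal_basis_wrt b E"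
  shows "x = (\<Sum>u\<in>E. b x u *\<^sub>R u)"
  using orthonormal_expansion_in_span[OF assms(1), of E x] orthonormal_independent(2)[OF assms(1), of E]
    assms(2) by (simp add: orthonormal_basis_wrt_def)

lemma orthonormal_basis_card:
  fixes E :: "'e::euclidean_space set"
  assumes "inner_form b" "orthonormal_basis_wrt b E"
  shows "finite E" "card E = DIM('e)"
proof -
  have E: "\<forall>u\<in>E. \<forall>v\<in>E. b u v = (if u = v then 1 else 0)" "span E = UNIV"
    using assms(2) by (auto simp: orthonormal_basis_wrt_def)
  show "finite E" by (rule orthonormal_independent(2)[OF assms(1) E(1)])
  show "card E = DIM('e)"
    using dim_eq_card_independent[OF orthonormal_independent(1)[OF assms(1) E(1)]] E(2)
    by (metis dim_UNIV dim_span)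
qed

text \<open>An orthonormal set of largest size spans, since a vector outside its span would yield
  one more element by a Gram-Schmidt step. Independence bounds the size by the dimension.\<close>

lemma orthonormal_basis_exists:
  fixes b :: "'e::euclidean_space \<Rightarrow> 'e \<Rightarrow> real"
  assumes b: "inner_form b"
  obtains E where "orthonormal_basis_wrt b E"
proof -
  define P where "P E \<longleftrightarrow> (\<forall>u\<in>E. \<forall>v\<in>E. b u v = (if u = v then 1 else 0))" for E
  have "card E \<le> DIM('e)" if "P E" for E
    using orthonormal_independent[OF b, of E] that independent_bound[of E] by (simp add: P_def)
  moreover have "P {}" by (simp add: P_def)
  ultimately obtain E where E: "P E" "\<And>F. P F \<Longrightarrow> card F \<le> card E"
    using ex_has_greatest_nat[of P "{}" card "Suc DIM('e)"] by (auto simp: less_Suc_eq_le)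
  have on: "\<forall>u\<in>E. \<forall>v\<in>E. b u v = (if u = v then 1 else 0)" using E(1) by (simp add: P_def)
  note fin = orthonormal_independent(2)[OF b on]
  have "span E = UNIV"
  proof (rule ccontr)
    assume "span E \<noteq> UNIV"
    then obtain x where x: "x \<notin> span E" by auto
    define y where "y = x - (\<Sum>u\<in>E. b x u *\<^sub>R u)"
    have "(\<Sum>u\<in>E. b x u *\<^sub>R u) \<in> span E" by (intro span_sum span_scale span_base)
    then have "y \<noteq> 0" using x by (auto simp: y_def)
    then have yy: "b y y > 0" by (rule inner_form_pos[OF b])
    have yE: "b y v = 0" if "v \<in> E" for v
    proof -
      have "b y v = b x v - (\<Sum>u\<in>E. b x u * b u v)"
        unfolding y_def by (simp add: inner_form_simps[OF b])
      also have "(\<Sum>u\<in>E. b x u * b u v) = (\<Sum>u\<in>E. if v = u then b x u else 0)"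
        using on that by (intro sum.cong) auto
      finally show ?thesis using fin that by simp
    qed
    define z where "z = (1 / sqrt (b y y)) *\<^sub>R y"
    have zE: "b z v = 0" "b v z = 0" if "v \<in> E" for v
      using yE[OF that] inner_form_sym[OF b, of v y] by (auto simp: z_def inner_form_simps[OF b])
    have zz: "b z z = 1"
      using yy by (simp add: z_def inner_form_simps[OF b])
    have "P (insert z E)" using on zE zz unfolding P_def by auto
    moreover have "z \<notin> E" using zE zz by fastforce
    ultimately show False using E(2)[of "insert z E"] fin by simp
  qed
  then show ?thesis using that[of E] on by (simp add: orthonormal_basis_wrt_def)
qed

lemma orthonormal_parseval:
  assumes b: "inner_form b" and E: "orthonormal_basis_wrt b E"
  shows "b v w = (\<Sum>u\<in>E. b v u * b w u)"
proof -
  have "b v w = b (\<Sum>u\<in>E. b v u *\<^sub>R u) w"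
    using orthonormal_basis_expansion[OF b E, of v] by simp
  also have "\<dots> = (\<Sum>u\<in>E. b v u * b w u)"
    by (simp only: inner_form_simps(5,9)[OF b]) (simp only: inner_form_sym[OF b, of w])
  finally show ?thesis .
qed

text \<open>\<open>trace_wrt\<close> takes its basis from a choice operator, so a way to exchange
  bases is needed. Expanding in \<open>F\<close> leaves sums over \<open>E\<close> that Parseval
  collapses to \<open>b v w\<close>.\<close>

lemma trace_basis_independent:
  fixes S :: "'e::euclidean_space \<Rightarrow> 'e \<Rightarrow> real"
  assumes b: "inner_form b" and E: "orthonormal_basis_wrt b E" and F: "orthonormal_basis_wrt b F"
    and S: "bilinear S"
  shows "(\<Sum>u\<in>E. S u u) = (\<Sum>u\<in>F. S u u)"
proof -
  have exp: "S u u = (\<Sum>v\<in>F. \<Sum>w\<in>F. b u v * b u w * S v w)" for u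
  proof -
    have "S u u = S (\<Sum>v\<in>F. b u v *\<^sub>R v) (\<Sum>w\<in>F. b u w *\<^sub>R w)"
      using orthonormal_basis_expansion[OF b F, of u] by simp
    also have "\<dots> = (\<Sum>v\<in>F. \<Sum>w\<in>F. b u v * b u w * S v w)"
      by (simp only: bilinear_real_simps[OF S] sum_distrib_left mult.assoc)
        (subst sum.swap, simp only: mult.left_commute)
    finally show ?thesis .
  qed
  have "(\<Sum>u\<in>E. S u u) = (\<Sum>v\<in>F. \<Sum>u\<in>E. \<Sum>w\<in>F. b u v * b u w * S v w)"
    unfolding exp by (rule sum.swap)
  also have "\<dots> = (\<Sum>v\<in>F. \<Sum>w\<in>F. \<Sum>u\<in>E. b u v * b u w * S v w)"
    by (intro sum.cong refl sum.swap)
  also have "\<dots> = (\<Sum>v\<in>F. \<Sum>w\<in>F. b v w * S v w)"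
  proof (intro sum.cong refl)
    fix v w
    have "(\<Sum>u\<in>E. b u v * b u w) = b v w"
      unfolding orthonormal_parseval[OF b E, of v w] by (intro sum.cong) (auto simp: inner_form_sym[OF b])
    then show "(\<Sum>u\<in>E. b u v * b u w * S v w) = b v w * S v w"
      by (simp add: sum_distrib_right[symmetric])
  qed
  also have "\<dots> = (\<Sum>v\<in>F. \<Sum>w\<in>F. if v = w then S v w else 0)"
    using F by (intro sum.cong refl) (auto simp: orthonormal_basis_wrt_def)
  also have "\<dots> = (\<Sum>u\<in>F. S u u)" using orthonormal_basis_card(1)[OF b F] by simp
  finally show ?thesis .
qed

text \<open>Connects the two traces in use: \<open>unimodular\<close> speaks of the matrix trace in
  the standard basis, whereas the tension field produces a sum over an orthonormal basis of the
  metric.\<close>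

lemma orthonormal_trace_matrix:
  fixes f :: "real ^ 'n \<Rightarrow> real ^ 'n"
  assumes b: "inner_form b" and E: "orthonormal_basis_wrt b E" and f: "linear f"
  shows "(\<Sum>u\<in>E. b (f u) u) = trace (matrix f)"
proof -
  have "trace (matrix f) = (\<Sum>i\<in>UNIV. f (axis i 1) \<bullet> axis i 1)"
    by (simp add: trace_def matrix_def inner_axis)
  also have "\<dots> = (\<Sum>i\<in>UNIV. \<Sum>u\<in>E. b (axis i 1) u * (f u \<bullet> axis i 1))"
  proof (rule sum.cong[OF refl])
    fix i :: 'n
    have "f (axis i 1) = f (\<Sum>u\<in>E. b (axis i 1) u *\<^sub>R u)"
      using orthonormal_basis_expansion[OF b E, of "axis i 1"] by simp
    also have "\<dots> = (\<Sum>u\<in>E. b (axis i 1) u *\<^sub>R f u)" by (simp add: linear_sum[OF f] linear_scale[OF f])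
    finally show "f (axis i 1) \<bullet> axis i 1 = (\<Sum>u\<in>E. b (axis i 1) u * (f u \<bullet> axis i 1))"
      by (simp add: inner_sum_left)
  qed
  also have "\<dots> = (\<Sum>u\<in>E. \<Sum>i\<in>UNIV. b (axis i 1) u * (f u \<bullet> axis i 1))" by (rule sum.swap)
  also have "\<dots> = (\<Sum>u\<in>E. b (f u) u)"
  proof (rule sum.cong[OF refl])
    fix u
    have "b (f u) u = b (\<Sum>i\<in>UNIV. (f u $ i) *\<^sub>R axis i 1) u"
      using basis_expansion[of "f u"] by (simp add: scalar_mult_eq_scaleR)
    also have "\<dots> = (\<Sum>i\<in>UNIV. (f u $ i) * b (axis i 1) u)"
      by (simp add: inner_form_simps[OF b])
    finally show "(\<Sum>i\<in>UNIV. b (axis i 1) u * (f u \<bullet> axis i 1)) = b (f u) u"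
      by (simp add: inner_axis mult.commute)
  qed
  finally show ?thesis by simp
qed

text \<open>Riesz representation provides an adjoint, so the choice in \<open>adjoint_wrt\<close>
  does return one.\<close>

lemma adjoint_wrt_works:
  assumes b: "inner_form b" and f: "linear f"
  shows "b (f x) y = b x (adjoint_wrt b f y)"
proof -
  have "\<exists>w. \<forall>x. b (f x) y = b x w" for y
  proof -
    have "linear (\<lambda>x. b (f x) y)"
      using linear_compose[OF f inner_form_linear(2)[OF b, of y]] by (simp add: o_def)
    from inner_form_riesz[OF b this] obtain w where "\<And>x. b w x = b (f x) y" by blast
    then show ?thesis using inner_form_sym[OF b] by metis
  qed
  then have "\<exists>f'. \<forall>x y. b (f x) y = b x (f' y)" by metis
  then show ?thesis unfolding adjoint_wrt_def by (rule someI2_ex) blast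
qed

text \<open>\<open>\<Gamma> + X' (X x)\<close> is the covariant derivative of \<open>X\<close> along itself, and the left argument on the
  right-hand side is the bracket \<open>[Y, X]\<close>.\<close>

lemma koszul_frame:
  fixes G :: "'e::euclidean_space \<Rightarrow> 'e \<Rightarrow> 'e \<Rightarrow> real"
  assumes S: "open S" "x \<in> S" and G: "\<And>y. y \<in> S \<Longrightarrow> inner_form (G y)"
    and G': "\<And>u v. ((\<lambda>y. G y u v) has_derivative G' u v) (at x)"
    and X: "(X has_derivative X') (at x)" and Y: "(Y has_derivative Y') (at x)"
    and const: "\<And>y. y \<in> S \<Longrightarrow> G y (X y) (X y) = a" "\<And>y. y \<in> S \<Longrightarrow> G y (X y) (Y y) = c"
    and \<Gamma>: "2 * G x \<Gamma> (Y x) = G' (X x) (Y x) (X x) + G' (X x) (Y x) (X x) - G' (X x) (X x) (Y x)"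
  shows "G x (\<Gamma> + X' (X x)) (Y x) = G x (X' (Y x) - Y' (X x)) (X x)"
proof -
  have bil: "\<And>y. y \<in> S \<Longrightarrow> bilinear (G y)" using G by (simp add: inner_form_def)
  have zero: "F' w = 0" if "(F has_derivative F') (at x)" "\<And>y. y \<in> S \<Longrightarrow> F y = k" for F :: "'e \<Rightarrow> real" and F' k w
  proof -
    have "((\<lambda>y. k) has_derivative F') (at x)"
      by (rule has_derivative_transform_within_open[OF that(1) S]) (use that in auto)
    from has_derivative_unique[OF this has_derivative_const] show ?thesis by simp
  qed
  \<comment> \<open>Differentiating the two constant products trades derivatives of the metric for
    derivatives of the fields. The first identity is used in direction \<open>Y x\<close>, the
    second in direction \<open>X x\<close>.\<close>
  have 1: "G' (X x) (X x) w + G x (X x) (X' w) + G x (X' w) (X x) = 0" for w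
    by (rule zero[OF has_derivative_bilinear_family[OF S bil G' X X] const(1)])
  have 2: "G' (X x) (Y x) w + G x (X x) (Y' w) + G x (X' w) (Y x) = 0" for w
    by (rule zero[OF has_derivative_bilinear_family[OF S bil G' X Y] const(2)])
  note sym = inner_form_sym[OF G[OF S(2)]]
  show ?thesis
    using 1[of "Y x"] 2[of "X x"] \<Gamma> sym[of "X x" "X' (Y x)"] sym[of "X x" "Y' (X x)"]
    by (simp add: bilinear_ladd[OF bil[OF S(2)]] bilinear_lsub[OF bil[OF S(2)]])
qed


section \<open>Derivatives in charts\<close>

lemma chart_inv_left: "is_chart c \<Longrightarrow> p \<in> fst c \<Longrightarrow> chart_inv c (snd c p) = p"
  by (simp add: is_chart_def homeomorphism_def)

lemma chart_inv_right: "x \<in> snd c ` fst c \<Longrightarrow> snd c (chart_inv c x) = x"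
  by (simp add: chart_inv_def f_inv_into_f)

lemma chart_inv_in: "x \<in> snd c ` fst c \<Longrightarrow> chart_inv c x \<in> fst c"
  by (simp add: chart_inv_def inv_into_into)

lemma open_chart_image:
  assumes "is_chart c" "open U"
  shows "open (snd c ` (fst c \<inter> U))"
proof -
  have "openin (top_of_set (snd c ` fst c)) (snd c ` (fst c \<inter> U))"
    using assms by (intro homeomorphism_imp_open_map[of "fst c" _ _ "chart_inv c"])
      (auto simp: is_chart_def openin_open)
  then show ?thesis using assms by (simp add: is_chart_def openin_open_eq)
qed

lemma smooth_atlas_is_chart: "smooth_atlas A \<Longrightarrow> c \<in> A \<Longrightarrow> is_chart c"
  by (simp add: smooth_atlas_def)

lemma chart_at:
  assumes "smooth_atlas A"
  shows "chart_at A p \<in> A" "p \<in> fst (chart_at A p)"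
proof -
  have "p \<in> (\<Union>c\<in>A. fst c)" using assms by (simp add: smooth_atlas_def)
  then have "\<exists>c. c \<in> A \<and> p \<in> fst c" by auto
  then show "chart_at A p \<in> A" "p \<in> fst (chart_at A p)"
    unfolding chart_at_def by (metis (mono_tags, lifting) someI_ex)+
qed

text \<open>Changes of chart and \<open>mdiff\<close> are all of this form, so that one chain rule covers them.\<close>

definition chart_deriv ::
  "('a, 'e::euclidean_space) chart \<Rightarrow> ('b, 'f::euclidean_space) chart \<Rightarrow> ('a \<Rightarrow> 'b) \<Rightarrow> 'a \<Rightarrow> 'e \<Rightarrow> 'f" where
  "chart_deriv c d f p = frechet_derivative (local_rep c d f) (at (snd c p))"

lemma smooth_map_id: "smooth_atlas A \<Longrightarrow> smooth_map A A id"
  by (auto simp: smooth_map_def smooth_atlas_def local_rep_def o_def)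

context
  fixes A :: "('a::topological_space, 'e::euclidean_space) chart set"
    and B :: "('b::topological_space, 'f::euclidean_space) chart set"
    and f :: "'a \<Rightarrow> 'b"
  assumes A: "smooth_atlas A" and f: "smooth_map A B f"
begin

lemma open_local_rep_domain:
  assumes "c \<in> A" "d \<in> B" "is_chart d"
  shows "open (snd c ` (fst c \<inter> f -` fst d))"
  using assms f by (intro open_chart_image open_vimage smooth_atlas_is_chart[OF A])
    (auto simp: smooth_map_def is_chart_def)

lemma local_rep_has_derivative:
  assumes "c \<in> A" "d \<in> B" "p \<in> fst c" "f p \<in> fst d"
  shows "(local_rep c d f has_derivative chart_deriv c d f p) (at (snd c p))"
  unfolding chart_deriv_def
  using assms f by (intro smooth_on_has_derivative[of "snd c ` (fst c \<inter> f -` fst d)"])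
    (auto simp: smooth_map_def)

lemma linear_chart_deriv:
  assumes "c \<in> A" "d \<in> B" "p \<in> fst c" "f p \<in> fst d"
  shows "linear (chart_deriv c d f p)"
  using has_derivative_linear[OF local_rep_has_derivative[OF assms]] .

end

text \<open>The local representations compose only where \<open>f\<close> lands in the chart
  \<open>d\<close>. That set is open around \<open>p\<close>, which is all a derivative asks
  for.\<close>

lemma chart_deriv_comp:
  assumes A: "smooth_atlas A" and B: "smooth_atlas B" and f: "smooth_map A B f" and g: "smooth_map B C g"
    and c: "c \<in> A" "p \<in> fst c" and d: "d \<in> B" "f p \<in> fst d" and k: "k \<in> C" "g (f p) \<in> fst k"
  shows "chart_deriv c k (\<lambda>q. g (f q)) p v = chart_deriv d k g (f p) (chart_deriv c d f p v)"
proof -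
  have eq: "local_rep c d f (snd c p) = snd d (f p)"
    by (simp add: local_rep_def chart_inv_left[OF smooth_atlas_is_chart[OF A c(1)] c(2)])
  have "((local_rep d k g \<circ> local_rep c d f) has_derivative
      (chart_deriv d k g (f p) \<circ> chart_deriv c d f p)) (at (snd c p))"
    using diff_chain_at[OF local_rep_has_derivative[OF A f c(1) d(1) c(2) d(2)], folded eq]
      local_rep_has_derivative[OF B g d(1) k(1) d(2) k(2)] by (simp add: eq)
  then have "(local_rep c k (\<lambda>q. g (f q)) has_derivative
      (chart_deriv d k g (f p) \<circ> chart_deriv c d f p)) (at (snd c p))"
    using c d f chart_inv_left[OF smooth_atlas_is_chart[OF A c(1)]] chart_inv_left[OF smooth_atlas_is_chart[OF B d(1)]]
    by (elim has_derivative_transform_within_open[where s = "snd c ` (fst c \<inter> f -` fst d)"])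
      (auto simp: local_rep_def intro!: open_local_rep_domain[OF A f] smooth_atlas_is_chart[OF B])
  then show ?thesis by (simp add: chart_deriv_def frechet_derivativeI)
qed

lemma chart_deriv_id:
  assumes "is_chart c" "p \<in> fst c"
  shows "chart_deriv c c id p v = v"
proof -
  have "(local_rep c c id has_derivative (\<lambda>v. v)) (at (snd c p))"
    using assms by (intro has_derivative_transform_within_open[OF has_derivative_ident, of "snd c ` fst c"])
      (auto simp: local_rep_def chart_inv_left is_chart_def)
  then show ?thesis by (simp add: chart_deriv_def frechet_derivativeI)
qed

lemma tangent_to_chart_eq: "tangent_to_chart A c q = chart_deriv (chart_at A q) c id q"
  by (simp add: tangent_to_chart_def chart_deriv_def)

lemma tangent_from_chart_eq: "tangent_from_chart A c q = chart_deriv c (chart_at A q) id q"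
  by (simp add: tangent_from_chart_def chart_deriv_def)

lemma mdiff_eq: "mdiff A B f p = chart_deriv (chart_at A p) (chart_at B (f p)) f p"
  by (simp add: mdiff_def chart_deriv_def)

lemma chart_deriv_id_inverse:
  assumes A: "smooth_atlas A" and "c \<in> A" "d \<in> A" "p \<in> fst c" "p \<in> fst d"
  shows "chart_deriv d c id p (chart_deriv c d id p v) = v"
  using chart_deriv_comp[OF A A smooth_map_id[OF A] smooth_map_id[OF A], of c p d c v] assms
    chart_deriv_id[OF smooth_atlas_is_chart[OF A], of c p v] by (simp add: id_def)

section \<open>Metrics, Christoffel symbols and the tension of the identity in a chart\<close>

lemma riemannian_metric_inner_form: "riemannian_metric A h \<Longrightarrow> inner_form (h p)"
  by (simp add: riemannian_metric_def inner_form_def)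

lemma form_rep_inner_form:
  assumes A: "smooth_atlas A" and h: "\<And>p. inner_form (h p)" and c: "c \<in> A" "x \<in> snd c ` fst c"
  shows "inner_form (form_rep A c h x)"
proof -
  define q where "q = chart_inv c x"
  define T where "T = tangent_from_chart A c q"
  have q: "q \<in> fst c" using chart_inv_in[OF c(2)] by (simp add: q_def)
  have lin: "linear T"
    unfolding T_def tangent_from_chart_eq
    using linear_chart_deriv[OF A smooth_map_id[OF A]] c q chart_at[OF A, of q] by auto
  \<comment> \<open>The reverse change of components is a left inverse of \<open>T\<close>.\<close>
  have inv: "T v \<noteq> 0" if "v \<noteq> 0" for v
    using chart_deriv_id_inverse[OF A c(1) chart_at(1)[OF A, of q] q chart_at(2)[OF A, of q], of v]
      linear_0[OF linear_chart_deriv[OF A smooth_map_id[OF A] chart_at(1)[OF A, of q] c(1) chart_at(2)[OF A, of q]]] q that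
    unfolding T_def tangent_from_chart_eq by auto
  have "bilinear (\<lambda>u v. h q (T u) (T v))"
    unfolding bilinear_def
    by (auto intro!: linearI simp: linear_add[OF lin] linear_scale[OF lin] inner_form_simps[OF h])
  then show ?thesis
    using inv inner_form_pos[OF h] inner_form_sym[OF h]
    unfolding form_rep_def inner_form_def T_def[symmetric] q_def[symmetric] by blast
qed

lemma form_rep_has_derivative:
  assumes h: "riemannian_metric A h" and c: "c \<in> A" "x \<in> snd c ` fst c"
  shows "((\<lambda>y. form_rep A c h y u v) has_derivative frechet_derivative (\<lambda>y. form_rep A c h y u v) (at x)) (at x)"
  using assms by (intro smooth_on_has_derivative[of "snd c ` fst c"]) (auto simp: riemannian_metric_def)

text \<open>The description in \<open>christoffel\<close> has exactly one solution: its right-hand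
  side is linear in \<open>z\<close>, so Riesz gives a vector, and nondegeneracy makes it
  unique.\<close>

lemma christoffel_works:
  fixes A :: "('a::topological_space, 'e::euclidean_space) chart set"
  assumes A: "smooth_atlas A" and h: "riemannian_metric A h" and c: "c \<in> A" "x \<in> snd c ` fst c"
  shows "2 * form_rep A c h x (christoffel A h c x u v) z =
        frechet_derivative (\<lambda>y. form_rep A c h y v z) (at x) u
        + frechet_derivative (\<lambda>y. form_rep A c h y u z) (at x) v
        - frechet_derivative (\<lambda>y. form_rep A c h y u v) (at x) z" (is "_ = ?R z")
proof -
  define G where "G = form_rep A c h"
  have ip: "inner_form (G y)" if "y \<in> snd c ` fst c" for y
    unfolding G_def using form_rep_inner_form[OF A riemannian_metric_inner_form[OF h] c(1) that] .
  have S: "open (snd c ` fst c)" using smooth_atlas_is_chart[OF A c(1)] by (simp add: is_chart_def)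
  have D: "((\<lambda>y. G y a b) has_derivative frechet_derivative (\<lambda>y. G y a b) (at x)) (at x)" for a b
    unfolding G_def by (rule form_rep_has_derivative[OF h c])
  have lin1: "linear (\<lambda>z. frechet_derivative (\<lambda>y. G y a z) (at x) b)" for a b
    by (rule linear_frechet_derivative_family[OF S c(2) inner_form_linear(1)[OF ip] D])
  have "linear ?R"
    using linear_compose_sub[OF linear_compose_add[OF lin1[of v u] lin1[of u v]] has_derivative_linear[OF D[of u v]]]
    by (simp only: G_def)
  then have "linear (\<lambda>z. ?R z / 2)"
    using linear_compose_scale_right[of ?R "1/2"] by simp
  from inner_form_riesz[OF ip[OF c(2)] this] obtain w where "\<And>z. G x w z = ?R z / 2" by blast
  then have w: "\<forall>z. 2 * G x w z = ?R z" by (simp add: mult.commute)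
  have "w' = w" if "\<forall>z. 2 * G x w' z = ?R z" for w'
  proof (rule inner_form_eqI[OF ip[OF c(2)]])
    fix z
    show "G x w' z = G x w z" using w[rule_format, of z] that[rule_format, of z] by linarith
  qed
  then show ?thesis
    using theI[of "\<lambda>w. \<forall>z. 2 * G x w z = ?R z" w] w
    unfolding christoffel_def G_def[symmetric] by blast
qed

text \<open>With the same preferred chart on both sides the identity is represented by the identity.
  Its derivative is locally constant, so only the difference of the Christoffel symbols survives in
  the second fundamental form.\<close>

lemma tension_id:
  assumes A: "smooth_atlas A" and c: "c = chart_at A p" "x = snd c p"
  shows "tension A g A h id p =
    trace_wrt (g p) (\<lambda>u v. christoffel A h c x u v - christoffel A g c x u v)"
proof -
  have ch: "is_chart c" "p \<in> fst c" using chart_at[OF A, of p] smooth_atlas_is_chart[OF A] c by auto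
  have S: "open (snd c ` fst c)" using ch by (simp add: is_chart_def)
  have x: "x \<in> snd c ` fst c" using ch c by simp
  have DF: "frechet_derivative (local_rep c c id) (at y) = (\<lambda>v. v)" if "y \<in> snd c ` fst c" for y
    using chart_deriv_id[OF ch(1) chart_inv_in[OF that]] chart_inv_right[OF that]
    by (auto simp: chart_deriv_def fun_eq_iff)
  have "((\<lambda>y. frechet_derivative (local_rep c c id) (at y) v) has_derivative (\<lambda>w. 0)) (at x)" for v
    by (rule has_derivative_transform_within_open[OF has_derivative_const S x]) (simp add: DF)
  from frechet_derivativeI[OF this]
  have "frechet_derivative (\<lambda>y. frechet_derivative (local_rep c c id) (at y) v) (at x) u = 0" for u v
    by metis
  moreover have "local_rep c c id x = x"
    using ch c by (simp add: local_rep_def chart_inv_left)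
  ultimately have "second_fundamental_form A g A h id p u v =
      christoffel A h c x u v - christoffel A g c x u v" for u v
    using DF[OF x] by (simp add: second_fundamental_form_def c[symmetric] Let_def)
  then show ?thesis unfolding tension_def by presburger
qed


section \<open>Lie groups\<close>

locale lie_group =
  fixes A :: "('a::{t2_space, second_countable_topology}, 'e::euclidean_space) chart set"
    and mul :: "'a \<Rightarrow> 'a \<Rightarrow> 'a" and e :: 'a and iv :: "'a \<Rightarrow> 'a"
  assumes lie: "connected_lie_group A mul e iv"
begin

lemma atlas: "smooth_atlas A"
  using lie by (simp add: connected_lie_group_def)

lemma group: "group mul e iv"
  using lie by (simp add: connected_lie_group_def)

lemma mul_assoc: "mul (mul a b) c = mul a (mul b c)"
  using group by (simp add: group_def semigroup.assoc)

lemma mul_e_left [simp]: "mul e a = a"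
  using group.group_left_neutral[OF group] .

lemma mul_iv_left [simp]: "mul (iv a) a = e"
  using group.left_inverse[OF group] .

lemma mul_iv_right [simp]: "mul a (iv a) = e"
  by (metis mul_assoc mul_e_left mul_iv_left)

lemma mul_e_right [simp]: "mul a e = a"
  by (metis mul_assoc mul_e_left mul_iv_left mul_iv_right)

lemma is_chart: "c \<in> A \<Longrightarrow> is_chart c"
  using smooth_atlas_is_chart[OF atlas] .

lemma open_chart: "c \<in> A \<Longrightarrow> open (snd c ` fst c)"
  using is_chart by (simp add: is_chart_def)

abbreviation (input) "ce \<equiv> chart_at A e"

lemma ce: "ce \<in> A" "e \<in> fst ce"
  using chart_at[OF atlas] by auto

section \<open>Multiplication and left translation in charts\<close>

definition mul_rep :: "('a, 'e) chart \<Rightarrow> ('a, 'e) chart \<Rightarrow> ('a, 'e) chart \<Rightarrow> 'e \<times> 'e \<Rightarrow> 'e" where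
  "mul_rep c d k z = snd k (mul (chart_inv c (fst z)) (chart_inv d (snd z)))"

definition mul_dom :: "('a, 'e) chart \<Rightarrow> ('a, 'e) chart \<Rightarrow> ('a, 'e) chart \<Rightarrow> ('e \<times> 'e) set" where
  "mul_dom c d k = {z \<in> snd c ` fst c \<times> snd d ` fst d. mul (chart_inv c (fst z)) (chart_inv d (snd z)) \<in> fst k}"

lemma continuous_mul: "continuous_on UNIV (\<lambda>(a, b). mul a b)"
  using lie by (simp add: connected_lie_group_def smooth_map_def)

lemma open_mul_dom:
  assumes "c \<in> A" "d \<in> A" "k \<in> A"
  shows "open (mul_dom c d k)"
proof -
  let ?V = "snd c ` fst c \<times> snd d ` fst d"
  have cont: "continuous_on (snd c ` fst c) (chart_inv c)" "continuous_on (snd d ` fst d) (chart_inv d)"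
    using is_chart assms by (auto simp: is_chart_def homeomorphism_def)
  have "continuous_on ?V (\<lambda>z. (chart_inv c (fst z), chart_inv d (snd z)))"
    by (intro continuous_on_Pair continuous_on_compose2[OF cont(1)] continuous_on_compose2[OF cont(2)]
        continuous_on_fst continuous_on_snd continuous_on_id) auto
  from continuous_on_compose2[OF continuous_mul this]
  have "continuous_on ?V (\<lambda>z. mul (chart_inv c (fst z)) (chart_inv d (snd z)))" by simp
  moreover have "open ?V" using open_chart assms by (intro open_Times) auto
  moreover have "open (fst k)" using is_chart assms by (simp add: is_chart_def)
  ultimately have "open (?V \<inter> (\<lambda>z. mul (chart_inv c (fst z)) (chart_inv d (snd z))) -` fst k)"
    by (rule continuous_open_preimage)
  moreover have "mul_dom c d k = ?V \<inter> (\<lambda>z. mul (chart_inv c (fst z)) (chart_inv d (snd z))) -` fst k"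
    by (auto simp: mul_dom_def)
  ultimately show ?thesis by simp
qed

text \<open>The product atlas inverts \<open>map_prod\<close> as one map on pairs, while
  \<open>mul_rep\<close> inverts the two factors separately. Injectivity of both charts shows that
  the results agree.\<close>

lemma smooth_mul_rep:
  assumes "c \<in> A" "d \<in> A" "k \<in> A"
  shows "smooth_on (mul_dom c d k) (mul_rep c d k)"
proof -
  let ?P = "(fst c \<times> fst d, map_prod (snd c) (snd d))"
  have 1: "smooth_on (snd ?P ` (fst ?P \<inter> (\<lambda>(a, b). mul a b) -` fst k)) (local_rep ?P k (\<lambda>(a, b). mul a b))"
  proof -
    have "?P \<in> prod_atlas A A"
      unfolding prod_atlas_def using assms by (intro image_eqI[of _ _ "(c, d)"]) auto
    moreover have "smooth_map (prod_atlas A A) A (\<lambda>(a, b). mul a b)"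
      using lie by (simp add: connected_lie_group_def)
    ultimately show ?thesis using assms(3) unfolding smooth_map_def by blast
  qed
  have 2: "snd ?P ` (fst ?P \<inter> (\<lambda>(a, b). mul a b) -` fst k) = mul_dom c d k"
  proof (intro equalityI subsetI)
    fix z assume "z \<in> mul_dom c d k"
    then obtain a b where "a \<in> fst c" "b \<in> fst d" "z = (snd c a, snd d b)" "mul a b \<in> fst k"
      using assms by (cases z) (auto simp: mul_dom_def chart_inv_left[OF is_chart])
    then show "z \<in> snd ?P ` (fst ?P \<inter> (\<lambda>(a, b). mul a b) -` fst k)"
      by (intro image_eqI[of _ _ "(a, b)"]) auto
  qed (use assms in \<open>auto simp: mul_dom_def chart_inv_left[OF is_chart]\<close>)
  have 3: "local_rep ?P k (\<lambda>(a, b). mul a b) z = mul_rep c d k z" if "z \<in> mul_dom c d k" for z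
  proof -
    obtain a b where ab: "a \<in> fst c" "b \<in> fst d" "z = (snd c a, snd d b)"
      using \<open>z \<in> mul_dom c d k\<close> by (cases z) (auto simp: mul_dom_def)
    have "inj_on (snd ?P) (fst ?P)"
      using map_prod_inj_on[of "snd c" "fst c" "snd d" "fst d"]
        inj_on_inverseI[of "fst c" "chart_inv c", OF chart_inv_left[OF is_chart[OF assms(1)]]]
        inj_on_inverseI[of "fst d" "chart_inv d", OF chart_inv_left[OF is_chart[OF assms(2)]]]
      by simp
    then have "chart_inv ?P z = (a, b)"
      unfolding chart_inv_def using ab by (intro inv_into_f_eq) auto
    then show ?thesis
      using ab assms by (simp add: local_rep_def mul_rep_def chart_inv_left[OF is_chart])
  qed
  show ?thesis
    using 1[unfolded 2]
      smooth_on_cong[OF open_mul_dom[OF assms], of "local_rep ?P k (\<lambda>(a, b). mul a b)", OF 3] by blast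
qed

text \<open>Left translation is multiplication with its first argument frozen at \<open>a\<close>,
  in coordinates the affine substitution of \<open>(snd ?b a, y)\<close>.\<close>

lemma smooth_left_translation: "smooth_map A A (mul a)"
  unfolding smooth_map_def
proof (intro conjI ballI)
  have pair: "continuous_on UNIV (\<lambda>b. (a, b))" by (intro continuous_intros)
  show cont: "continuous_on UNIV (mul a)"
    using continuous_on_compose2[OF continuous_mul pair] by simp
  fix c d assume cd: "c \<in> A" "d \<in> A"
  let ?b = "chart_at A a"
  have b: "?b \<in> A" "a \<in> fst ?b" using chart_at[OF atlas] by auto
  let ?S = "snd c ` (fst c \<inter> mul a -` fst d)"
  have "open (mul a -` fst d)" using cont is_chart[OF cd(2)] by (simp add: is_chart_def open_vimage)
  then have S: "open ?S" by (rule open_chart_image[OF is_chart[OF cd(1)]])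
  have "smooth_on ?S (\<lambda>y. mul_rep ?b c d ((snd ?b a, 0) + (0, y)))"
    using cd b by (intro smooth_on_affine_compose[OF open_mul_dom S _ _ smooth_mul_rep])
      (auto simp: mul_dom_def chart_inv_left[OF is_chart] intro!: bounded_linear_Pair bounded_linear_zero bounded_linear_ident)
  then show "smooth_on ?S (local_rep c d (mul a))"
    using b by (simp add: mul_rep_def local_rep_def o_def chart_inv_left[OF is_chart])
qed

text \<open>The left invariant field of \<open>u\<close> in the coordinates of the chart \<open>c\<close>.\<close>

definition frame :: "('a, 'e) chart \<Rightarrow> 'e \<Rightarrow> 'e \<Rightarrow> 'e" where
  "frame c u x = chart_deriv ce c (mul (chart_inv c x)) e u"

lemma linear_frame:
  assumes "c \<in> A" "x \<in> snd c ` fst c"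
  shows "linear (\<lambda>u. frame c u x)"
  unfolding frame_def
  using linear_chart_deriv[OF atlas smooth_left_translation ce(1) assms(1) ce(2)] chart_inv_in[OF assms(2)] by simp

text \<open>Translating \<open>v\<close> back to \<open>e\<close> by \<open>iv q\<close> gives a
  preimage, because the two translations compose to the identity.\<close>

lemma surj_frame:
  assumes "c \<in> A" "x \<in> snd c ` fst c"
  obtains u where "frame c u x = v"
proof -
  define q where "q = chart_inv c x"
  have q: "q \<in> fst c" using assms chart_inv_in by (simp add: q_def)
  have "chart_deriv ce c (mul q) e (chart_deriv c ce (mul (iv q)) q v) = chart_deriv c c (\<lambda>r. mul q (mul (iv q) r)) q v"
    using chart_deriv_comp[OF atlas atlas smooth_left_translation smooth_left_translation assms(1) q ce(1) _ assms(1)]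
      q ce by simp
  also have "(\<lambda>r. mul q (mul (iv q) r)) = id" by (simp add: fun_eq_iff mul_assoc[symmetric])
  finally show ?thesis
    using that chart_deriv_id[OF is_chart[OF assms(1)] q] by (simp only: frame_def q_def)
qed

lemma frame_e: "frame ce u (snd ce e) = u"
proof -
  have "mul e = id" by (simp add: fun_eq_iff)
  then show ?thesis
    using ce chart_deriv_id[OF is_chart] by (simp add: frame_def chart_inv_left[OF is_chart])
qed

text \<open>The frame is the partial derivative of multiplication in its second argument at
  \<open>e\<close>. As a function of the first argument it is a slice of a derivative of
  \<open>mul_rep\<close>, hence smooth.\<close>

lemma smooth_frame:
  assumes c: "c \<in> A"
  shows "smooth_on (snd c ` fst c) (frame c u)"
proof -
  let ?y = "snd ce e"
  have dom: "(x, ?y) \<in> mul_dom ce' ce c \<longleftrightarrow> x \<in> snd ce' ` fst ce' \<and> chart_inv ce' x \<in> fst c" if "ce' \<in> A" for x ce'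
    using ce by (auto simp: mul_dom_def chart_inv_left[OF is_chart])
  have D: "smooth_on (mul_dom c ce c) (\<lambda>z. frechet_derivative (mul_rep c ce c) (at z) (0, u))"
    using smooth_on_frechet_derivative[OF smooth_mul_rep[OF c ce(1) c]] .
  have "smooth_on (snd c ` fst c) (\<lambda>x. frechet_derivative (mul_rep c ce c) (at ((0, ?y) + (x, 0))) (0, u))"
    using dom[OF c] chart_inv_in[of _ c]
    by (intro smooth_on_affine_compose[OF open_mul_dom[OF c ce(1) c] open_chart[OF c] _ _ D])
      (auto intro!: bounded_linear_Pair bounded_linear_zero bounded_linear_ident)
  moreover have "frechet_derivative (mul_rep c ce c) (at ((0, ?y) + (x, 0))) (0, u) = frame c u x"
    if x: "x \<in> snd c ` fst c" for x
  proof -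
    have 1: "(mul_rep c ce c has_derivative frechet_derivative (mul_rep c ce c) (at (x, ?y))) (at (x, ?y))"
      using dom[OF c] x chart_inv_in[OF x] by (intro smooth_on_has_derivative[OF smooth_mul_rep[OF c ce(1) c]]) auto
    have 2: "((\<lambda>y. (x, y)) has_derivative (\<lambda>w. (0, w))) (at ?y)"
      by (auto intro!: derivative_eq_intros)
    have "((\<lambda>y. mul_rep c ce c (x, y)) has_derivative (\<lambda>w. frechet_derivative (mul_rep c ce c) (at (x, ?y)) (0, w))) (at ?y)"
      using has_derivative_compose[OF 2 1] .
    moreover have "(\<lambda>y. mul_rep c ce c (x, y)) = local_rep ce c (mul (chart_inv c x))"
      by (simp add: fun_eq_iff mul_rep_def local_rep_def)
    ultimately show ?thesis
      using frechet_derivativeI by (fastforce simp: frame_def chart_deriv_def)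
  qed
  ultimately show ?thesis
    using smooth_on_cong[OF open_chart[OF c],
        of "\<lambda>x. frechet_derivative (mul_rep c ce c) (at ((0, ?y) + (x, 0))) (0, u)" "frame c u"] by blast
qed

lemma frame_has_derivative:
  assumes "c \<in> A" "x \<in> snd c ` fst c"
  shows "(frame c u has_derivative frechet_derivative (frame c u) (at x)) (at x)"
  using smooth_on_has_derivative[OF smooth_frame[OF assms(1)] assms(2)] .

section \<open>Left invariant fields and their brackets in a fixed chart\<close>

lemma tangent_to_chart_frame:
  assumes c: "c \<in> A" "q \<in> fst c"
  shows "tangent_to_chart A c q (left_invariant_field A mul e u q) = frame c u (snd c q)"
  using chart_deriv_comp[OF atlas atlas smooth_left_translation[of q] smooth_map_id[OF atlas] ce chart_at(1)[OF atlas, of q] _ c(1), of u]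
    c chart_at(2)[OF atlas, of q]
  by (simp add: tangent_to_chart_eq left_invariant_field_def mdiff_eq frame_def chart_inv_left[OF is_chart])

lemma tangent_from_chart_frame:
  assumes c: "c \<in> A" "q \<in> fst c"
  shows "tangent_from_chart A c q (frame c u (snd c q)) = left_invariant_field A mul e u q"
  using chart_deriv_comp[OF atlas atlas smooth_left_translation[of q] smooth_map_id[OF atlas] ce c(1) _ chart_at(1)[OF atlas, of q], of u]
    c chart_at(2)[OF atlas, of q]
  by (simp add: tangent_from_chart_eq left_invariant_field_def mdiff_eq frame_def chart_inv_left[OF is_chart])

lemma field_rep_frame:
  assumes c: "c \<in> A" "x \<in> snd c ` fst c"
  shows "field_rep A c (left_invariant_field A mul e u) x = frame c u x"
  using tangent_to_chart_frame[OF c(1) chart_inv_in[OF c(2)]] chart_inv_right[OF c(2)]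
  by (simp add: field_rep_def)

lemma left_invariant_on_fields:
  assumes "left_invariant A mul h"
  shows "h q (left_invariant_field A mul e u q) (left_invariant_field A mul e v q) = h e u v"
  using assms[unfolded left_invariant_def, rule_format, of q e u v] by (simp add: left_invariant_field_def)

lemma form_rep_frame:
  assumes c: "c \<in> A" "x \<in> snd c ` fst c" and h: "left_invariant A mul h"
  shows "form_rep A c h x (frame c u x) (frame c v x) = h e u v"
  using tangent_from_chart_frame[OF c(1) chart_inv_in[OF c(2)]] chart_inv_right[OF c(2)]
    left_invariant_on_fields[OF h] by (simp add: form_rep_def)

text \<open>In the preferred chart at \<open>e\<close> the frame of \<open>u\<close> has the value
  \<open>u\<close> there, so the undifferentiated fields in the bracket formula become plain
  \<open>w\<close> and \<open>u\<close>.\<close>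

lemma ad_frame:
  "ad A mul e w u = frechet_derivative (frame ce u) (at (snd ce e)) w - frechet_derivative (frame ce w) (at (snd ce e)) u"
proof -
  have x: "snd ce e \<in> snd ce ` fst ce" using ce by simp
  have "frechet_derivative (field_rep A ce (left_invariant_field A mul e u)) (at (snd ce e)) =
      frechet_derivative (frame ce u) (at (snd ce e))" for u
    by (rule frechet_derivativeI[OF has_derivative_transform_within_open
          [OF frame_has_derivative[OF ce(1) x] open_chart[OF ce(1)] x]]) (simp add: field_rep_frame ce)
  then show ?thesis
    using field_rep_frame[OF ce(1) x] frame_e by (simp add: ad_def field_bracket_def Let_def)
qed

lemma bilinear_ad: "bilinear (ad A mul e)"
proof -
  let ?x = "snd ce e"
  have x: "?x \<in> snd ce ` fst ce" using ce by simp
  have 1: "linear (\<lambda>u. frechet_derivative (frame ce u) (at ?x) w)" for w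
    by (rule linear_frechet_derivative_family[where B = "\<lambda>y u. frame ce u y", OF open_chart[OF ce(1)] x])
      (auto intro!: linear_frame frame_has_derivative ce)
  have 2: "linear (frechet_derivative (frame ce u) (at ?x))" for u
    using has_derivative_linear[OF frame_has_derivative[OF ce(1) x]] .
  show ?thesis
    unfolding bilinear_def ad_frame
    using linear_compose_sub[OF 1 2] linear_compose_sub[OF 2 1] by blast
qed

text \<open>In charts the left translation \<open>F\<close> by \<open>p\<close> maps left invariant fields to themselves. Differentiating
  \<open>DF(y)(X(y)) = X(F(y))\<close> and antisymmetrising removes the second derivative of \<open>F\<close>.\<close>

lemma frame_bracket:
  assumes c: "c \<in> A" "x \<in> snd c ` fst c"
  shows "frechet_derivative (frame c u) (at x) (frame c w x) - frechet_derivative (frame c w) (at x) (frame c u x) =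
    frame c (ad A mul e w u) x"
proof -
  define p where "p = chart_inv c x"
  have p: "p \<in> fst c" "x = snd c p" using chart_inv_in[OF c(2)] chart_inv_right[OF c(2)] by (simp_all add: p_def)
  define F where "F = local_rep ce c (mul p)"
  let ?y = "snd ce e"
  define S where "S = snd ce ` (fst ce \<inter> mul p -` fst c)"
  have S: "open S"
    unfolding S_def using open_local_rep_domain[OF atlas smooth_left_translation ce(1) c(1) is_chart[OF c(1)]] .
  have y: "?y \<in> S" using ce p by (auto simp: S_def)
  have y': "?y \<in> snd ce ` fst ce" using ce by simp
  have Fy: "F ?y = x" using ce p by (simp add: F_def local_rep_def chart_inv_left[OF is_chart])
  have smF: "smooth_on S F"
    using smooth_left_translation[of p] ce c by (simp add: smooth_map_def S_def F_def)
  let ?D = "\<lambda>y. frechet_derivative F (at y)"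
  have DF: "?D z (frame ce v z) = frame c v (F z)" if "z \<in> S" for z v
  proof -
    obtain q where q: "q \<in> fst ce" "mul p q \<in> fst c" "z = snd ce q"
      using \<open>z \<in> S\<close> by (auto simp: S_def)
    have "frame c v (F z) = chart_deriv ce c (\<lambda>r. mul p (mul q r)) e v"
      using q ce c by (simp add: frame_def F_def local_rep_def chart_inv_left[OF is_chart] mul_assoc[symmetric])
    also have "\<dots> = chart_deriv ce c (mul p) q (chart_deriv ce ce (mul q) e v)"
      using chart_deriv_comp[OF atlas atlas smooth_left_translation[of q] smooth_left_translation[of p] ce ce(1) _ c(1)] q
      by simp
    also have "\<dots> = ?D z (frame ce v z)"
      using q ce by (simp add: frame_def F_def chart_deriv_def chart_inv_left[OF is_chart])
    finally show ?thesis by simp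
  qed
  have linD: "linear (?D z)" if "z \<in> S" for z
    using has_derivative_linear[OF smooth_on_has_derivative[OF smF that]] .
  have D2: "((\<lambda>z. ?D z v) has_derivative frechet_derivative (\<lambda>z. ?D z v) (at ?y)) (at ?y)" for v
    using smooth_on_has_derivative[OF smooth_on_frechet_derivative[OF smF] y] .
  let ?X = "\<lambda>v. frechet_derivative (frame ce v) (at ?y)"
  let ?Y = "\<lambda>v. frechet_derivative (frame c v) (at x)"
  have eq: "frechet_derivative (\<lambda>z. ?D z u) (at ?y) w + ?D ?y (?X u w) = ?Y u (frame c w x)" for u w
  proof -
    have 1: "((\<lambda>z. ?D z (frame ce u z)) has_derivative
        (\<lambda>w. frechet_derivative (\<lambda>z. ?D z u) (at ?y) w + ?D ?y (?X u w))) (at ?y)"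
      using has_derivative_linear_family[OF S y linD D2 frame_has_derivative[OF ce(1) y', of u]]
      by (simp add: frame_e)
    have "((\<lambda>z. frame c u (F z)) has_derivative (\<lambda>w. ?Y u (?D ?y w))) (at ?y)"
      using has_derivative_compose[OF smooth_on_has_derivative[OF smF y], of "frame c u" "?Y u"]
        frame_has_derivative[OF c, of u] Fy by simp
    then have 2: "((\<lambda>z. ?D z (frame ce u z)) has_derivative (\<lambda>w. ?Y u (?D ?y w))) (at ?y)"
      by (rule has_derivative_transform_within_open[OF _ S y]) (simp add: DF)
    have "?D ?y w = frame c w x" using DF[OF y, of w] by (simp add: frame_e Fy)
    then show ?thesis using fun_cong[OF has_derivative_unique[OF 1 2], of w] by simp
  qed
  have "frechet_derivative (\<lambda>z. ?D z u) (at ?y) w = frechet_derivative (\<lambda>z. ?D z w) (at ?y) u"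
    using smF by (intro symmetric_second_derivative[OF S y]) (simp only: smooth_on_def)
  then have "?Y u (frame c w x) - ?Y w (frame c u x) = ?D ?y (?X u w) - ?D ?y (?X w u)"
    unfolding eq[symmetric] by simp
  also have "\<dots> = ?D ?y (ad A mul e w u)"
    by (simp add: ad_frame linear_diff[OF linD[OF y]])
  also have "\<dots> = frame c (ad A mul e w u) x"
    using DF[OF y, of "ad A mul e w u"] by (simp add: frame_e Fy)
  finally show ?thesis .
qed

text \<open>Left invariance makes the metric constant on pairs of frame fields, as
  \<open>koszul_frame\<close> requires, and \<open>frame_bracket\<close> evaluates the resulting
  bracket through \<open>ad\<close>. The right-hand side no longer depends on the point.\<close>

lemma christoffel_frame:
  assumes h: "riemannian_metric A h" "left_invariant A mul h" and c: "c \<in> A" "x \<in> snd c ` fst c"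
  shows "form_rep A c h x (christoffel A h c x (frame c u x) (frame c u x)
      + frechet_derivative (frame c u) (at x) (frame c u x)) (frame c w x) = h e (ad A mul e w u) u"
proof -
  have "form_rep A c h x (christoffel A h c x (frame c u x) (frame c u x)
      + frechet_derivative (frame c u) (at x) (frame c u x)) (frame c w x) =
    form_rep A c h x (frechet_derivative (frame c u) (at x) (frame c w x)
      - frechet_derivative (frame c w) (at x) (frame c u x)) (frame c u x)"
  proof (rule koszul_frame[where S = "snd c ` fst c" and a = "h e u u" and c = "h e u w" and
        G' = "\<lambda>u v. frechet_derivative (\<lambda>y. form_rep A c h y u v) (at x)"])
    show "inner_form (form_rep A c h y)" if "y \<in> snd c ` fst c" for y
      using form_rep_inner_form[OF atlas riemannian_metric_inner_form[OF h(1)] c(1) that] .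
    show "form_rep A c h y (frame c u y) (frame c w y) = h e u w" if "y \<in> snd c ` fst c" for y
      using form_rep_frame[OF c(1) that h(2)] .
    show "form_rep A c h y (frame c u y) (frame c u y) = h e u u" if "y \<in> snd c ` fst c" for y
      using form_rep_frame[OF c(1) that h(2)] .
  qed (use open_chart c form_rep_has_derivative[OF h(1) c] frame_has_derivative[OF c] christoffel_works[OF atlas h(1) c]
      in \<open>simp_all\<close>)
  then show ?thesis by (simp add: frame_bracket[OF c] form_rep_frame[OF c h(2)])
qed

end


section \<open>The tension field of the identity tested against left invariant fields\<close>

context lie_group
begin

abbreviation (input) "lfield \<equiv> left_invariant_field A mul e"

lemma left_invariant_field_frame: "lfield u p = frame (chart_at A p) u (snd (chart_at A p) p)"
  using chart_inv_left[OF is_chart chart_at(2)[OF atlas]] chart_at(1)[OF atlas]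
  by (simp add: left_invariant_field_def mdiff_eq frame_def)

lemma left_invariant_field_e [simp]: "lfield u e = u"
  by (simp add: left_invariant_field_frame frame_e)

lemma linear_left_invariant_field: "linear (\<lambda>u. lfield u p)"
  unfolding left_invariant_field_frame
  using linear_frame[OF chart_at(1)[OF atlas]] chart_at(2)[OF atlas] by blast

lemma surj_left_invariant_field: "surj (\<lambda>u. lfield u p)"
  unfolding surj_def
proof
  fix v
  obtain u where "frame (chart_at A p) u (snd (chart_at A p) p) = v"
    by (rule surj_frame[OF chart_at(1)[OF atlas] imageI[OF chart_at(2)[OF atlas]]])
  then show "\<exists>u. v = lfield u p" unfolding left_invariant_field_frame by blast
qed

lemma inj_left_invariant_field: "inj (\<lambda>u. lfield u p)"
  using linear_surjective_imp_injective[OF linear_left_invariant_field surj_left_invariant_field] by simp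

lemma mdiff_left_invariant_field: "mdiff A A (mul a) p (lfield u p) = lfield u (mul a p)"
proof -
  have "(\<lambda>r. mul a (mul p r)) = mul (mul a p)" by (simp add: mul_assoc fun_eq_iff)
  then show ?thesis
    using chart_deriv_comp[OF atlas atlas smooth_left_translation[of p] smooth_left_translation[of a] ce
        chart_at(1)[OF atlas, of p] _ chart_at(1)[OF atlas, of "mul a p"], of u]
      chart_at(2)[OF atlas, of p] chart_at(2)[OF atlas, of "mul a p"]
    by (simp add: left_invariant_field_def mdiff_eq)
qed

text \<open>At a point seen in its own preferred chart there is no change of components; this turns
  the chart formulas into statements about \<open>h p\<close>.\<close>

lemma form_rep_chart_at: "form_rep A (chart_at A p) h (snd (chart_at A p) p) = h p"
  using chart_inv_left[OF is_chart[OF chart_at(1)[OF atlas]] chart_at(2)[OF atlas, of p]]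
    chart_deriv_id[OF is_chart[OF chart_at(1)[OF atlas]] chart_at(2)[OF atlas, of p]]
  by (simp add: form_rep_def tangent_from_chart_eq fun_eq_iff)

text \<open>The trace at \<open>p\<close> runs over a basis at \<open>p\<close>, while the final
  condition lives on the Lie algebra. Left invariant fields identify the two tangent spaces
  isometrically for \<open>g\<close>.\<close>

lemma orthonormal_basis_pullback:
  assumes g: "left_invariant A mul g" and E: "orthonormal_basis_wrt (g p) E"
  shows "orthonormal_basis_wrt (g e) ((\<lambda>u. lfield u p) -` E)"
proof -
  let ?T = "\<lambda>u. lfield u p"
  have "?T ` (?T -` E) = E" using surj_left_invariant_field by (simp add: surj_image_vimage_eq)
  then have "?T ` span (?T -` E) = ?T ` UNIV"
    using linear_span_image[OF linear_left_invariant_field[of p], of "?T -` E"] E surj_left_invariant_field[of p]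
    by (simp add: orthonormal_basis_wrt_def)
  then have "span (?T -` E) = UNIV"
    using inj_image_eq_iff[OF inj_left_invariant_field] by blast
  moreover have "g e u v = (if u = v then 1 else 0)" if "u \<in> ?T -` E" "v \<in> ?T -` E" for u v
  proof -
    have "g e u v = g p (?T u) (?T v)" by (simp only: left_invariant_on_fields[OF g])
    also have "\<dots> = (if ?T u = ?T v then 1 else 0)" using E that by (simp add: orthonormal_basis_wrt_def)
    finally show ?thesis by (simp only: inj_eq[OF inj_left_invariant_field])
  qed
  ultimately show ?thesis unfolding orthonormal_basis_wrt_def by blast
qed

text \<open>Adding \<open>dX\<^sub>u(X\<^sub>u)\<close> to the Christoffel symbols of both metrics turns them into the covariant
  derivatives of the left invariant field \<open>X\<^sub>u\<close>; those of \<open>g\<close> sum to zero by unimodularity.\<close>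

lemma tension_left_invariant:
  assumes g: "riemannian_metric A g" "left_invariant A mul g"
    and h: "riemannian_metric A h" "left_invariant A mul h"
    and uni: "\<And>w E. orthonormal_basis_wrt (g e) E \<Longrightarrow> (\<Sum>u\<in>E. g e (ad A mul e w u) u) = 0"
    and E: "orthonormal_basis_wrt (g e) E"
  shows "h p (tension A g A h id p) (lfield w p) = (\<Sum>u\<in>E. h e (ad A mul e w u) u)"
proof -
  let ?c = "chart_at A p"
  let ?x = "snd ?c p"
  let ?T = "\<lambda>u. lfield u p"
  have c: "?c \<in> A" "?x \<in> snd ?c ` fst ?c" using chart_at[OF atlas, of p] by auto
  \<comment> \<open>The basis that \<open>trace_wrt\<close> selects at \<open>p\<close>. It may vary
    wildly with \<open>p\<close>, so it is pulled back to \<open>e\<close> and exchanged for the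
    fixed \<open>E\<close> at the end.\<close>
  define F where "F = (SOME E. orthonormal_basis_wrt (g p) E)"
  have F: "orthonormal_basis_wrt (g p) F"
    unfolding F_def using orthonormal_basis_exists[OF riemannian_metric_inner_form[OF g(1)], of p] by (metis someI_ex)
  define F' where "F' = ?T -` F"
  have F': "orthonormal_basis_wrt (g e) F'"
    unfolding F'_def by (rule orthonormal_basis_pullback[where g = g, OF g(2) F])
  have F_eq: "F = ?T ` F'" using surj_left_invariant_field by (simp add: F'_def surj_image_vimage_eq)
  define D where "D u = frechet_derivative (frame ?c u) (at ?x) (?T u)" for u
  define H where "H u = christoffel A h ?c ?x (?T u) (?T u) + D u" for u
  define K where "K u = christoffel A g ?c ?x (?T u) (?T u) + D u" for u
  have H: "h p (H u) (?T w) = h e (ad A mul e w u) u" for u w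
    using christoffel_frame[OF h c, of u w]
    by (simp add: H_def D_def form_rep_chart_at left_invariant_field_frame)
  have K: "g p (K u) (?T w) = g e (ad A mul e w u) u" for u w
    using christoffel_frame[OF g c, of u w]
    by (simp add: K_def D_def form_rep_chart_at left_invariant_field_frame)
  have "(\<Sum>u\<in>F'. K u) = 0"
  proof (rule inner_form_eqI[OF riemannian_metric_inner_form[OF g(1), of p]])
    fix z
    obtain w where w: "z = ?T w" using surj_left_invariant_field[of p] by (metis surjD)
    show "g p (\<Sum>u\<in>F'. K u) z = g p 0 z"
      using uni[OF F', of w]
      by (simp add: w K inner_form_simps[OF riemannian_metric_inner_form[OF g(1), of p]])
  qed
  \<comment> \<open>\<open>D u\<close> cancels in \<open>H u - K u\<close>, which leaves the
    difference of Christoffel symbols from \<open>tension_id\<close>.\<close>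
  moreover have "tension A g A h id p = (\<Sum>u\<in>F'. H u - K u)"
    unfolding tension_id[OF atlas refl refl] trace_wrt_def F_def[symmetric] F_eq
    using inj_left_invariant_field[of p]
    by (subst sum.reindex) (auto simp: H_def K_def intro: inj_on_subset)
  ultimately have "h p (tension A g A h id p) (?T w) = (\<Sum>u\<in>F'. h e (ad A mul e w u) u)"
    by (simp add: sum_subtractf inner_form_simps[OF riemannian_metric_inner_form[OF h(1), of p]] H)
  also have "\<dots> = (\<Sum>u\<in>E. h e (ad A mul e w u) u)"
  proof (rule trace_basis_independent[OF riemannian_metric_inner_form[OF g(1), of e] F' E,
        where S = "\<lambda>u v. h e (ad A mul e w u) v"])
    show "bilinear (\<lambda>u v. h e (ad A mul e w u) v)"
      using inner_form_simps[OF riemannian_metric_inner_form[OF h(1), of e]]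
        bilinear_radd[OF bilinear_ad, of w] bilinear_rmul[OF bilinear_ad, of w]
      by (auto simp: bilinear_def intro!: linearI)
  qed
  finally show ?thesis .
qed

text \<open>By \<open>tension_left_invariant\<close> the products of the tension field with left
  invariant fields do not depend on \<open>p\<close>, and these fields exhaust every tangent space.
  Vanishing at \<open>e\<close> therefore forces vanishing everywhere.\<close>

lemma harmonic_id_iff:
  assumes g: "riemannian_metric A g" "left_invariant A mul g"
    and h: "riemannian_metric A h" "left_invariant A mul h"
    and uni: "\<And>w E. orthonormal_basis_wrt (g e) E \<Longrightarrow> (\<Sum>u\<in>E. g e (ad A mul e w u) u) = 0"
    and E: "orthonormal_basis_wrt (g e) E"
  shows "harmonic A g A h id \<longleftrightarrow> (\<forall>w. (\<Sum>u\<in>E. h e (ad A mul e w u) u) = 0)"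
proof -
  have T: "h p (tension A g A h id p) (lfield w p) = (\<Sum>u\<in>E. h e (ad A mul e w u) u)" for p w
    by (rule tension_left_invariant[OF g h uni E])
  note ip = riemannian_metric_inner_form[OF h(1)]
  show ?thesis
  proof
    assume "harmonic A g A h id"
    then have "tension A g A h id e = 0" by (simp add: harmonic_def)
    then show "\<forall>w. (\<Sum>u\<in>E. h e (ad A mul e w u) u) = 0"
      using T[of e] by (simp add: inner_form_simps[OF ip])
  next
    assume 0: "\<forall>w. (\<Sum>u\<in>E. h e (ad A mul e w u) u) = 0"
    have "tension A g A h id p = 0" for p
    proof (rule inner_form_eqI[OF ip[of p]])
      fix z
      obtain w where "z = lfield w p" using surj_left_invariant_field[of p] by (metis surjD)
      then show "h p (tension A g A h id p) z = h p 0 z"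
        using 0 T[of p w] by (simp add: inner_form_simps[OF ip])
    qed
    then show "harmonic A g A h id" by (simp add: harmonic_def smooth_map_id[OF atlas])
  qed
qed

text \<open>For a \<open>g e\<close>-orthonormal basis \<open>\<epsilon>\<close> this is the form
  with matrix \<open>M\<close> on the dual left invariant coframe. Each covector is written as the
  product under \<open>g\<close> with a left invariant field, so smoothness and invariance are
  inherited from \<open>g\<close> and the fields.\<close>

definition metric_of ::
  "('a \<Rightarrow> 'e \<Rightarrow> 'e \<Rightarrow> real) \<Rightarrow> ('i::finite \<Rightarrow> 'e) \<Rightarrow> real ^ 'i ^ 'i \<Rightarrow> 'a \<Rightarrow> 'e \<Rightarrow> 'e \<Rightarrow> real" where
  "metric_of g \<epsilon> M p u v =
     (\<Sum>i\<in>UNIV. \<Sum>j\<in>UNIV. M $ i $ j * (g p (lfield (\<epsilon> i) p) u * g p (lfield (\<epsilon> j) p) v))"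

lemma left_invariant_metric_of:
  assumes "left_invariant A mul g"
  shows "left_invariant A mul (metric_of g \<epsilon> M)"
  using assms unfolding left_invariant_def metric_of_def mdiff_left_invariant_field[symmetric] by simp

lemma metric_of_fields:
  assumes "left_invariant A mul g"
  shows "metric_of g \<epsilon> M p (lfield u p) (lfield v p) =
    (\<Sum>i\<in>UNIV. \<Sum>j\<in>UNIV. M $ i $ j * (g e (\<epsilon> i) u * g e (\<epsilon> j) v))"
  by (simp add: metric_of_def left_invariant_on_fields[OF assms])

text \<open>Smoothness of \<open>g\<close> in a chart is given for constant arguments, whereas the
  frame varies; expanding the frame in \<open>Basis\<close> reduces one to the other.\<close>

lemma smooth_metric_of:
  assumes g: "riemannian_metric A g" and c: "c \<in> A"
  shows "smooth_on (snd c ` fst c) (\<lambda>x. form_rep A c (metric_of g \<epsilon> M) x u v)"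
proof -
  let ?G = "form_rep A c g"
  note S = open_chart[OF c]
  have ip: "inner_form (?G x)" if "x \<in> snd c ` fst c" for x
    using form_rep_inner_form[OF atlas riemannian_metric_inner_form[OF g] c that] .
  have 1: "smooth_on (snd c ` fst c) (\<lambda>x. ?G x (frame c a x) b)" for a b
  proof -
    have "smooth_on (snd c ` fst c) (\<lambda>x. \<Sum>k\<in>Basis. (frame c a x \<bullet> k) * ?G x k b)"
      using g c by (intro smooth_on_sum smooth_on_mult S smooth_on_bounded_linear[OF S bounded_linear_inner_left] smooth_frame)
        (auto simp: riemannian_metric_def)
    moreover have "(\<Sum>k\<in>Basis. (frame c a x \<bullet> k) * ?G x k b) = ?G x (frame c a x) b" if "x \<in> snd c ` fst c" for x
      using linear_expansion[OF inner_form_linear(2)[OF ip[OF that], where v = b], where v = "frame c a x"] by simp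
    ultimately show ?thesis
      using smooth_on_cong[OF S, of "\<lambda>x. \<Sum>k\<in>Basis. (frame c a x \<bullet> k) * ?G x k b" "\<lambda>x. ?G x (frame c a x) b"]
      by blast
  qed
  have "form_rep A c (metric_of g \<epsilon> M) x u v =
      (\<Sum>i\<in>UNIV. \<Sum>j\<in>UNIV. M $ i $ j * (?G x (frame c (\<epsilon> i) x) u * ?G x (frame c (\<epsilon> j) x) v))"
    if "x \<in> snd c ` fst c" for x
    using tangent_from_chart_frame[OF c chart_inv_in[OF that]] chart_inv_right[OF that]
    by (simp add: form_rep_def metric_of_def)
  moreover have "smooth_on (snd c ` fst c)
      (\<lambda>x. \<Sum>i\<in>UNIV. \<Sum>j\<in>UNIV. M $ i $ j * (?G x (frame c (\<epsilon> i) x) u * ?G x (frame c (\<epsilon> j) x) v))"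
    by (intro smooth_on_sum smooth_on_mult smooth_on_const 1 S)
  ultimately show ?thesis
    using smooth_on_cong[OF S, of "\<lambda>x. form_rep A c (metric_of g \<epsilon> M) x u v"
        "\<lambda>x. \<Sum>i\<in>UNIV. \<Sum>j\<in>UNIV. M $ i $ j * (?G x (frame c (\<epsilon> i) x) u * ?G x (frame c (\<epsilon> j) x) v)"]
    by blast
qed

lemma bilinear_metric_of:
  assumes "riemannian_metric A g"
  shows "bilinear (metric_of g \<epsilon> M p)"
  unfolding bilinear_def metric_of_def
  by (intro conjI allI linearI)
    (simp_all add: inner_form_simps[OF riemannian_metric_inner_form[OF assms]] distrib_left distrib_right
      sum.distrib sum_distrib_left mult.left_commute mult.assoc)

lemma linear_metric_of: "linear (metric_of g \<epsilon>)"
  by (rule linearI)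
    (simp_all add: metric_of_def fun_eq_iff scaleR_fun_def distrib_right sum.distrib sum_distrib_left mult.assoc)

section \<open>Left invariant metrics as matrices in an orthonormal basis\<close>

context
  fixes g :: "'a \<Rightarrow> 'e \<Rightarrow> 'e \<Rightarrow> real" and \<epsilon> :: "'i::finite \<Rightarrow> 'e"
  assumes g: "riemannian_metric A g" "left_invariant A mul g"
    and \<epsilon>: "inj \<epsilon>" "orthonormal_basis_wrt (g e) (range \<epsilon>)"
begin

lemma orthonormal_frame: "g e (\<epsilon> i) (\<epsilon> j) = (if i = j then 1 else 0)"
  using \<epsilon> by (auto simp: orthonormal_basis_wrt_def inj_eq)

lemma metric_of_basis: "metric_of g \<epsilon> M p (lfield (\<epsilon> i) p) (lfield (\<epsilon> j) p) = M $ i $ j"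
proof -
  have "metric_of g \<epsilon> M p (lfield (\<epsilon> i) p) (lfield (\<epsilon> j) p) =
      (\<Sum>k\<in>UNIV. \<Sum>l\<in>UNIV. if l = j then (if k = i then M $ k $ l else 0) else 0)"
    unfolding metric_of_fields[OF g(2)] by (intro sum.cong) (auto simp: orthonormal_frame)
  then show ?thesis by simp
qed

lemma inj_metric_of: "inj (metric_of g \<epsilon>)"
proof (rule injI)
  fix M N assume eq: "metric_of g \<epsilon> M = metric_of g \<epsilon> N"
  show "M = N" unfolding vec_eq_iff using metric_of_basis eq by metis
qed

lemma frame_expansion: "u = (\<Sum>i\<in>UNIV. g e (\<epsilon> i) u *\<^sub>R \<epsilon> i)"
  using orthonormal_basis_expansion[OF riemannian_metric_inner_form[OF g(1)] \<epsilon>(2), of u] \<epsilon>(1)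
    inner_form_sym[OF riemannian_metric_inner_form[OF g(1)], of e u]
  by (simp add: sum.reindex)

text \<open>Left invariant fields reach every tangent vector, so both sides are determined by their
  values at \<open>e\<close>, and there by the basis.\<close>

lemma metric_of_eq:
  assumes h: "left_invariant A mul h" "\<And>p. inner_form (h p)"
  shows "h = metric_of g \<epsilon> (\<chi> i j. h e (\<epsilon> i) (\<epsilon> j))"
proof (intro ext)
  fix p u' v'
  obtain u v where uv: "u' = lfield u p" "v' = lfield v p"
    using surj_left_invariant_field[of p] by (metis surjD)
  have "h p u' v' = h e (\<Sum>i\<in>UNIV. g e (\<epsilon> i) u *\<^sub>R \<epsilon> i) (\<Sum>i\<in>UNIV. g e (\<epsilon> i) v *\<^sub>R \<epsilon> i)"
    unfolding uv left_invariant_on_fields[OF h(1)] using frame_expansion by metis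
  also have "\<dots> = (\<Sum>j\<in>UNIV. \<Sum>i\<in>UNIV. h e (\<epsilon> i) (\<epsilon> j) * (g e (\<epsilon> i) u * g e (\<epsilon> j) v))"
    by (simp add: inner_form_simps[OF h(2)] sum_distrib_left mult.commute mult.left_commute)
  also have "\<dots> = metric_of g \<epsilon> (\<chi> i j. h e (\<epsilon> i) (\<epsilon> j)) p u' v'"
    unfolding uv metric_of_fields[OF g(2)] by (subst sum.swap) simp
  finally show "h p u' v' = metric_of g \<epsilon> (\<chi> i j. h e (\<epsilon> i) (\<epsilon> j)) p u' v'" .
qed

text \<open>On the left invariant field of a vector with coordinates \<open>x\<close> the quadratic
  form is \<open>x \<bullet> (M *v x)\<close> at every point, so positivity of the matrix and of the
  metric are the same condition.\<close>

lemma riemannian_metric_of_iff: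
  "riemannian_metric A (metric_of g \<epsilon> M) \<longleftrightarrow> transpose M = M \<and> (\<forall>x. x \<noteq> 0 \<longrightarrow> 0 < x \<bullet> (M *v x))"
proof
  assume h: "riemannian_metric A (metric_of g \<epsilon> M)"
  note ip = riemannian_metric_inner_form[OF h, of e]
  have M: "metric_of g \<epsilon> M e (\<epsilon> i) (\<epsilon> j) = M $ i $ j" for i j using metric_of_basis[of M e i j] by simp
  have "x \<bullet> (M *v x) > 0" if "x \<noteq> 0" for x
  proof -
    define u where "u = (\<Sum>i\<in>UNIV. x $ i *\<^sub>R \<epsilon> i)"
    have gu: "g e (\<epsilon> i) u = x $ i" for i
      by (simp add: u_def inner_form_simps[OF riemannian_metric_inner_form[OF g(1)]] orthonormal_frame
          if_distrib cong: if_cong)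
    have "u \<noteq> 0"
      using gu that inner_form_simps(8)[OF riemannian_metric_inner_form[OF g(1)], of e] by (auto simp: vec_eq_iff)
    from inner_form_pos[OF ip this] show ?thesis
      using metric_of_fields[OF g(2), of \<epsilon> M e u u]
      by (simp add: gu inner_vec_def matrix_vector_mult_def sum_distrib_left mult.left_commute)
  qed
  moreover have "M $ i $ j = M $ j $ i" for i j
    using M inner_form_sym[OF ip] by metis
  ultimately show "transpose M = M \<and> (\<forall>x. x \<noteq> 0 \<longrightarrow> 0 < x \<bullet> (M *v x))"
    by (simp add: transpose_def vec_eq_iff)
next
  assume M: "transpose M = M \<and> (\<forall>x. x \<noteq> 0 \<longrightarrow> 0 < x \<bullet> (M *v x))"
  then have sym: "M $ i $ j = M $ j $ i" for i j by (simp add: transpose_def vec_eq_iff)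
  have "metric_of g \<epsilon> M p u v = metric_of g \<epsilon> M p v u" for p u v
    unfolding metric_of_def by (subst sum.swap) (simp add: sym mult.commute)
  moreover have "0 < metric_of g \<epsilon> M p u' u'" if "u' \<noteq> 0" for p u'
  proof -
    obtain u where u: "u' = lfield u p" using surj_left_invariant_field[of p] by (metis surjD)
    have "u \<noteq> 0" using that u linear_0[OF linear_left_invariant_field, of p] by auto
    define x where "x = (\<chi> i. g e (\<epsilon> i) u)"
    have "x \<noteq> 0"
    proof
      assume "x = 0"
      then have "(\<Sum>i\<in>UNIV. g e (\<epsilon> i) u *\<^sub>R \<epsilon> i) = 0" by (simp add: x_def vec_eq_iff)
      with frame_expansion[of u] have "u = 0" by (rule trans)
      with \<open>u \<noteq> 0\<close> show False ..
    qed
    then have "0 < x \<bullet> (M *v x)" using M by blast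
    also have "\<dots> = metric_of g \<epsilon> M p u' u'"
      unfolding u metric_of_fields[OF g(2)]
      by (simp add: x_def inner_vec_def matrix_vector_mult_def sum_distrib_left mult.left_commute)
    finally show ?thesis .
  qed
  ultimately show "riemannian_metric A (metric_of g \<epsilon> M)"
    unfolding riemannian_metric_def using bilinear_metric_of[OF g(1)] smooth_metric_of[OF g(1)] by blast
qed

lemma harmonic_cone_eq:
  assumes uni: "\<And>w E. orthonormal_basis_wrt (g e) E \<Longrightarrow> (\<Sum>u\<in>E. g e (ad A mul e w u) u) = 0"
  shows "harmonic_cone A mul g = metric_of g \<epsilon> `
    {M. transpose M = M \<and> (\<forall>x. x \<noteq> 0 \<longrightarrow> 0 < x \<bullet> (M *v x)) \<and>
        (\<forall>w. M \<bullet> (\<chi> i j. g e (\<epsilon> i) (ad A mul e w (\<epsilon> j))) = 0)}"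
proof -
  \<comment> \<open>Putting \<open>\<epsilon> j\<close> into the second slot picks out a column of
    \<open>M\<close>, so the trace becomes an entrywise product of matrices.\<close>
  have tr: "(\<Sum>u\<in>range \<epsilon>. metric_of g \<epsilon> M e (ad A mul e w u) u) =
      M \<bullet> (\<chi> i j. g e (\<epsilon> i) (ad A mul e w (\<epsilon> j)))" for M w
  proof -
    have "metric_of g \<epsilon> M e (ad A mul e w (\<epsilon> j)) (\<epsilon> j) = (\<Sum>i\<in>UNIV. M $ i $ j * g e (\<epsilon> i) (ad A mul e w (\<epsilon> j)))" for j
      using metric_of_fields[OF g(2), of \<epsilon> M e "ad A mul e w (\<epsilon> j)" "\<epsilon> j"]
      by (simp add: orthonormal_frame if_distrib cong: if_cong)
    then have "(\<Sum>u\<in>range \<epsilon>. metric_of g \<epsilon> M e (ad A mul e w u) u) =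
        (\<Sum>j\<in>UNIV. \<Sum>i\<in>UNIV. M $ i $ j * g e (\<epsilon> i) (ad A mul e w (\<epsilon> j)))"
      using \<epsilon>(1) by (simp add: sum.reindex)
    then show ?thesis by (subst (asm) sum.swap) (simp add: inner_vec_def)
  qed
  have in_cone: "metric_of g \<epsilon> M \<in> harmonic_cone A mul g \<longleftrightarrow>
      transpose M = M \<and> (\<forall>x. x \<noteq> 0 \<longrightarrow> 0 < x \<bullet> (M *v x)) \<and>
        (\<forall>w. M \<bullet> (\<chi> i j. g e (\<epsilon> i) (ad A mul e w (\<epsilon> j))) = 0)" for M
  proof (cases "riemannian_metric A (metric_of g \<epsilon> M)")
    case True
    have "harmonic A g A (metric_of g \<epsilon> M) id \<longleftrightarrow> (\<forall>w. M \<bullet> (\<chi> i j. g e (\<epsilon> i) (ad A mul e w (\<epsilon> j))) = 0)"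
      unfolding tr[symmetric] by (rule harmonic_id_iff[OF g True left_invariant_metric_of[OF g(2)] uni \<epsilon>(2)])
    then show ?thesis
      using True riemannian_metric_of_iff[of M] left_invariant_metric_of[OF g(2), of \<epsilon> M]
      by (simp add: harmonic_cone_def)
  next
    case False
    then show ?thesis unfolding harmonic_cone_def using riemannian_metric_of_iff[of M] by blast
  qed
  have "h \<in> range (metric_of g \<epsilon>)" if "h \<in> harmonic_cone A mul g" for h
  proof -
    have h: "riemannian_metric A h" "left_invariant A mul h" using that by (auto simp: harmonic_cone_def)
    show ?thesis using metric_of_eq[OF h(2) riemannian_metric_inner_form[OF h(1)]] by blast
  qed
  then have "harmonic_cone A mul g = metric_of g \<epsilon> ` {M. metric_of g \<epsilon> M \<in> harmonic_cone A mul g}"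
    by blast
  then show ?thesis by (simp only: in_cone)
qed

text \<open>By nondegeneracy an operator plus its adjoint vanishes iff the associated bilinear form
  does, and that form is tested on the basis, where it is the matrix of the operator plus its
  transpose.\<close>

lemma Kill_eq:
  "Kill A mul e g = {w. (\<chi> i j. g e (\<epsilon> i) (ad A mul e w (\<epsilon> j))) +
    transpose (\<chi> i j. g e (\<epsilon> i) (ad A mul e w (\<epsilon> j))) = 0}"
proof -
  note ip = riemannian_metric_inner_form[OF g(1), of e]
  have "ad A mul e w + adjoint_wrt (g e) (ad A mul e w) = 0 \<longleftrightarrow>
      (\<forall>i j. g e (\<epsilon> i) (ad A mul e w (\<epsilon> j)) + g e (\<epsilon> j) (ad A mul e w (\<epsilon> i)) = 0)" for w
  proof -
    let ?a = "ad A mul e w"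
    have lin: "linear ?a" using bilinear_ad by (simp add: bilinear_def)
    let ?b = "\<lambda>x y. g e x (?a y) + g e y (?a x)"
    have adj: "g e x (?a y + adjoint_wrt (g e) ?a y) = ?b x y" for x y
      using adjoint_wrt_works[OF ip lin, of x y] inner_form_sym[OF ip, of "?a x" y]
      by (simp add: inner_form_simps[OF ip])
    have "?a + adjoint_wrt (g e) ?a = 0 \<longleftrightarrow> (\<forall>y. ?a y + adjoint_wrt (g e) ?a y = 0)"
      by (simp add: fun_eq_iff)
    also have "\<dots> \<longleftrightarrow> (\<forall>x y. ?b x y = 0)"
      using adj inner_form_eqI[OF ip, of _ 0] inner_form_sym[OF ip] inner_form_simps(7,8)[OF ip] by metis
    also have "\<dots> \<longleftrightarrow> (\<forall>i j. ?b (\<epsilon> i) (\<epsilon> j) = 0)"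
    proof
      assume 0: "\<forall>i j. ?b (\<epsilon> i) (\<epsilon> j) = 0"
      have bil: "bilinear ?b"
        unfolding bilinear_def
        by (auto intro!: linearI simp: inner_form_simps[OF ip] linear_add[OF lin] linear_scale[OF lin] algebra_simps)
      have "?b x y = 0" if "x \<in> span (range \<epsilon>)" "y \<in> span (range \<epsilon>)" for x y
        using bilinear_eq[OF bil, of "\<lambda>x y. 0" UNIV "range \<epsilon>" UNIV "range \<epsilon>" x y] 0 \<epsilon>(2)
        by (auto simp: bilinear_def linear_zero orthonormal_basis_wrt_def)
      then show "\<forall>x y. ?b x y = 0" using \<epsilon>(2) by (simp add: orthonormal_basis_wrt_def)
    qed auto
    finally show ?thesis .
  qed
  then show ?thesis
    by (simp add: Kill_def vec_eq_iff transpose_def)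
qed

end

end


section \<open>Symmetric matrices\<close>

lemma subspace_symmetric: "subspace {M :: real ^ 'n ^ 'n. transpose M = M}"
  by (auto simp: subspace_def transpose_def vec_eq_iff)

text \<open>A basis is indexed by the sets of one or two indices: singletons give the diagonal
  units, pairs the symmetric off-diagonal ones. Disjoint supports make them orthogonal.\<close>

lemma dim_symmetric:
  "dim {M :: real ^ 'n ^ 'n. transpose M = M} = CARD('n) + (CARD('n) choose 2)"
proof -
  define J :: "'n set set" where "J = {T. card T = 1} \<union> {T. card T = 2}"
  define E :: "'n set \<Rightarrow> real ^ 'n ^ 'n" where "E T = (\<chi> i j. if {i, j} = T then 1 else 0)" for T
  have J: "\<exists>i j. T = {i, j}" if "T \<in> J" for T
    using that by (auto simp: J_def card_1_singleton_iff card_2_iff)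
  have inJ: "{i, j} \<in> J" for i j
    by (auto simp: J_def card_insert_if)
  have entry: "E {i, j} $ i $ j = 1" for i j by (simp add: E_def)
  have "inj_on E J"
  proof (rule inj_onI)
    fix T U assume "T \<in> J" "U \<in> J" "E T = E U"
    then obtain i j where "T = {i, j}" using J by blast
    then have "E U $ i $ j = 1" using entry \<open>E T = E U\<close> by metis
    then show "T = U" using \<open>T = {i, j}\<close> by (simp add: E_def split: if_splits)
  qed
  have "E T \<bullet> E U = 0" if "T \<noteq> U" for T U
  proof -
    have "E T $ i $ j * E U $ i $ j = 0" for i j using that by (simp add: E_def)
    then show ?thesis by (simp only: inner_vec_def inner_real_def sum.neutral_const)
  qed
  then have "pairwise orthogonal (E ` J)"
    unfolding pairwise_def orthogonal_def by (metis imageE)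
  moreover have "0 \<notin> E ` J"
    using J entry by (metis (no_types, lifting) imageE zero_index zero_neq_one)
  ultimately have ind: "independent (E ` J)" by (rule pairwise_orthogonal_independent)
  have "span (E ` J) = {M. transpose M = M}"
  proof
    have "E T \<in> {M. transpose M = M}" for T
      by (simp add: E_def transpose_def vec_eq_iff insert_commute)
    then show "span (E ` J) \<subseteq> {M. transpose M = M}"
      by (intro span_minimal subspace_symmetric) auto
    show "{M. transpose M = M} \<subseteq> span (E ` J)"
    proof
      fix M :: "real ^ 'n ^ 'n" assume "M \<in> {M. transpose M = M}"
      then have sym: "M $ i $ j = M $ j $ i" for i j by (simp add: transpose_def vec_eq_iff)
      \<comment> \<open>Chooses an order for the indices in \<open>T\<close>; by symmetry of
        \<open>M\<close> every order gives the same entry.\<close>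
      define f where "f T = (let p = SOME p. {fst p, snd p} = T in M $ fst p $ snd p)" for T
      have f: "f {i, j} = M $ i $ j" for i j
      proof -
        define p where "p = (SOME p. {fst p, snd p} = {i, j})"
        have "{fst p, snd p} = {i, j}"
          unfolding p_def by (rule someI[of _ "(i, j)"]) simp
        then have "M $ fst p $ snd p = M $ i $ j"
          using sym by (auto simp: doubleton_eq_iff)
        then show ?thesis by (simp add: f_def p_def Let_def)
      qed
      have "M $ i $ j = (\<Sum>T\<in>J. f T *\<^sub>R E T) $ i $ j" for i j
      proof -
        have "(\<Sum>T\<in>J. f T *\<^sub>R E T) $ i $ j = (\<Sum>T\<in>J. if {i, j} = T then f T else 0)"
          unfolding sum_component vector_scaleR_component by (rule sum.cong) (auto simp: E_def)
        then show ?thesis using inJ f by simp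
      qed
      then have "M = (\<Sum>T\<in>J. f T *\<^sub>R E T)" by (simp add: vec_eq_iff)
      moreover have "(\<Sum>T\<in>J. f T *\<^sub>R E T) \<in> span (E ` J)"
        by (intro span_sum span_scale span_base) auto
      ultimately show "M \<in> span (E ` J)" by simp
    qed
  qed
  then have "dim {M :: real ^ 'n ^ 'n. transpose M = M} = card (E ` J)"
    using dim_eq_card_independent[OF ind] dim_span by metis
  also have "\<dots> = card J" using \<open>inj_on E J\<close> by (rule card_image)
  also have "card J = card {T :: 'n set. card T = 1} + card {T :: 'n set. card T = 2}"
    unfolding J_def by (rule card_Un_disjoint) auto
  also have "\<dots> = CARD('n) + (CARD('n) choose 2)"
    using n_subsets[of "UNIV :: 'n set" 1] n_subsets[of "UNIV :: 'n set" 2] by simp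
  finally show ?thesis .
qed

lemma inner_transpose: "transpose M \<bullet> N = M \<bullet> transpose (N :: real ^ 'n ^ 'n)"
proof -
  have "transpose M \<bullet> N = (\<Sum>i\<in>UNIV. \<Sum>j\<in>UNIV. M $ j $ i * N $ i $ j)"
    by (simp add: inner_vec_def transpose_def)
  also have "\<dots> = (\<Sum>j\<in>UNIV. \<Sum>i\<in>UNIV. M $ j $ i * N $ i $ j)" by (rule sum.swap)
  finally show ?thesis by (simp add: inner_vec_def transpose_def)
qed

text \<open>The orthogonal complement \<open>N\<close> of the kernel is mapped injectively onto the
  whole range.\<close>

lemma dim_range_plus_dim_kernel:
  fixes f :: "'a::euclidean_space \<Rightarrow> 'b::euclidean_space"
  assumes f: "linear f"
  shows "dim (range f) + dim {x. f x = 0} = DIM('a)"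
proof -
  let ?K = "{x. f x = 0}"
  have K: "subspace ?K" using linear_subspace_kernel[OF f] .
  define N where "N = {y. \<forall>x\<in>?K. orthogonal x y}"
  have N: "subspace N" unfolding N_def by (rule subspace_orthogonal_to_vectors)
  have dimN: "dim N + dim ?K = DIM('a)"
    using dim_subspace_orthogonal_to_vectors[OF K subspace_UNIV] by (simp add: N_def)
  have "inj_on f (span N)"
  proof (subst span_eq_iff[THEN iffD2, OF N], rule inj_onI)
    fix x y assume "x \<in> N" "y \<in> N" "f x = f y"
    then have "x - y \<in> N" "x - y \<in> ?K" using N f by (auto simp: subspace_diff linear_diff)
    then show "x = y" by (auto simp: N_def orthogonal_def)
  qed
  then have "dim (f ` N) = dim N" by (rule dim_image_eq[OF f])
  moreover have "f ` N = range f"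
  proof
    show "range f \<subseteq> f ` N"
    proof
      fix z assume "z \<in> range f"
      then obtain x where x: "z = f x" by blast
      obtain y w where yw: "y \<in> span ?K" "\<And>v. v \<in> span ?K \<Longrightarrow> orthogonal w v" "x = y + w"
        using orthogonal_subspace_decomp_exists[of ?K x] by blast
      have "w \<in> N" using yw(2)[OF span_base] by (auto simp: N_def orthogonal_commute)
      moreover have "f x = f w" using yw(1,3) K f by (simp add: span_eq_iff[THEN iffD2] linear_add)
      ultimately show "z \<in> f ` N" using x by blast
    qed
  qed auto
  ultimately show ?thesis using dimN by simp
qed

lemma trace_inner_mat: "mat 1 \<bullet> (M :: real ^ 'n ^ 'n) = trace M"
  by (simp add: inner_vec_def mat_def trace_def if_distrib[of "\<lambda>x. x * _"] cong: if_cong)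

text \<open>Any \<open>M\<close> in \<open>W\<close> is a multiple of the difference between
  \<open>mat 1 + t *\<^sub>R M\<close> and \<open>mat 1\<close>, and for small \<open>t\<close> both
  of these lie in the positive definite part; for \<open>mat 1\<close> this is the trace
  hypothesis.\<close>

lemma span_positive_definite_section:
  fixes K :: "'b \<Rightarrow> real ^ 'n ^ 'n"
  assumes tr: "\<And>w. trace (K w) = 0"
  defines "W \<equiv> {M. transpose M = M \<and> (\<forall>w. M \<bullet> K w = 0)}"
  shows "span {M. transpose M = M \<and> (\<forall>x. x \<noteq> 0 \<longrightarrow> 0 < x \<bullet> (M *v x)) \<and> (\<forall>w. M \<bullet> K w = 0)} = span W"
    (is "span ?C = _")
proof
  show "span ?C \<subseteq> span W" by (rule span_mono) (auto simp: W_def)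
  have one: "mat 1 \<in> ?C" using tr by (simp add: trace_inner_mat)
  have "W \<subseteq> span ?C"
  proof
    fix M assume M: "M \<in> W"
    obtain B where B: "B > 0" "\<And>x. norm (M *v x) \<le> B * norm x"
      using linear_bounded_pos[OF matrix_vector_mul_linear[of M]] by blast
    \<comment> \<open>With this \<open>t\<close> the perturbation changes the quadratic form by at
      most half of \<open>(norm x)\<^sup>2\<close>.\<close>
    define t where "t = 1 / (2 * B)"
    have t: "t > 0" "t * B = 1 / 2" using B(1) by (auto simp: t_def)
    have "x \<bullet> ((mat 1 + t *\<^sub>R M) *v x) > 0" if "x \<noteq> 0" for x
    proof -
      have "\<bar>x \<bullet> (M *v x)\<bar> \<le> norm x * (B * norm x)"
        using Cauchy_Schwarz_ineq2[of x "M *v x"] mult_left_mono[OF B(2)[of x] norm_ge_zero[of x]] by linarith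
      then have "t * \<bar>x \<bullet> (M *v x)\<bar> \<le> t * (norm x * (B * norm x))" using t(1) by (simp add: mult_left_mono)
      also have "\<dots> = (t * B) * (norm x)\<^sup>2" by (simp add: power2_eq_square)
      finally have "\<bar>t * (x \<bullet> (M *v x))\<bar> \<le> (norm x)\<^sup>2 / 2" using t by (simp add: abs_mult)
      moreover have "x \<bullet> ((mat 1 + t *\<^sub>R M) *v x) = (norm x)\<^sup>2 + t * (x \<bullet> (M *v x))"
        by (simp add: matrix_vector_mult_add_rdistrib scaleR_matrix_vector_assoc[symmetric]
            inner_add_right power2_norm_eq_inner)
      ultimately show ?thesis using that zero_less_power[of "norm x" 2, unfolded zero_less_norm_iff]
          abs_ge_minus_self[of "t * (x \<bullet> (M *v x))"]
        by linarith
    qed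
    moreover have "transpose (mat 1 + t *\<^sub>R M) = mat 1 + t *\<^sub>R M"
      using M by (simp add: W_def transpose_def vec_eq_iff mat_def)
    ultimately have "mat 1 + t *\<^sub>R M \<in> ?C"
      using M tr by (simp add: W_def inner_add_left trace_inner_mat)
    then have "(1 / t) *\<^sub>R ((mat 1 + t *\<^sub>R M) - mat 1) \<in> span ?C"
      using one by (intro span_scale span_diff span_base)
    then show "M \<in> span ?C" using t by simp
  qed
  then show "span W \<subseteq> span ?C" by (simp add: span_minimal)
qed

text \<open>Against a symmetric matrix, \<open>S w\<close> has twice the inner product of
  \<open>K w\<close>, so the solutions form an orthogonal complement of \<open>range S\<close>;
  rank-nullity then brings in the kernel of \<open>S\<close>. Sums on both sides avoid subtraction
  of natural numbers.\<close>

lemma dim_positive_definite_section: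
  fixes K :: "'b::euclidean_space \<Rightarrow> real ^ 'n ^ 'n"
  assumes K: "linear K" and tr: "\<And>w. trace (K w) = 0"
  shows "dim {M. transpose M = M \<and> (\<forall>x. x \<noteq> 0 \<longrightarrow> 0 < x \<bullet> (M *v x)) \<and> (\<forall>w. M \<bullet> K w = 0)} + DIM('b) =
    CARD('n) + (CARD('n) choose 2) + dim {w. K w + transpose (K w) = 0}"
    (is "dim ?C + _ = _")
proof -
  define S where "S w = K w + transpose (K w)" for w
  have S: "linear S"
    by (rule linearI) (simp_all add: S_def linear_add[OF K] linear_scale[OF K] transpose_def vec_eq_iff algebra_simps)
  have sym: "range S \<subseteq> {M. transpose M = M}" by (auto simp: S_def transpose_def vec_eq_iff)
  have "{M. transpose M = M \<and> (\<forall>w. M \<bullet> K w = 0)} = {M \<in> {M. transpose M = M}. \<forall>N\<in>range S. orthogonal N M}"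
  proof -
    have "S w \<bullet> M = 2 * (M \<bullet> K w)" if "transpose M = M" for M w
      using inner_transpose[of "K w" M] that by (simp add: S_def inner_add_left inner_commute[of M])
    then show ?thesis by (auto simp: orthogonal_def)
  qed
  moreover have "dim (span ?C) = dim (span {M. transpose M = M \<and> (\<forall>w. M \<bullet> K w = 0)})"
    by (simp only: span_positive_definite_section[OF tr])
  ultimately have "dim ?C = dim {M \<in> {M. transpose M = M}. \<forall>N\<in>range S. orthogonal N M}"
    by (simp only: dim_span)
  moreover have "subspace (range S)" using linear_subspace_image[OF S subspace_UNIV] .
  ultimately have "dim ?C + dim (range S) = CARD('n) + (CARD('n) choose 2)"
    using dim_subspace_orthogonal_to_vectors[OF _ subspace_symmetric sym] dim_symmetric[where 'n = 'n] by simp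
  then show ?thesis
    using dim_range_plus_dim_kernel[OF S] by (simp add: S_def)
qed

lemma real_choose_two: "real (m choose 2) = real m * (real m - 1) / 2"
  by (induction m) (simp_all add: numeral_2_eq_2 field_simps)

theorem proposition3p10:
  fixes A :: "('a::{t2_space, second_countable_topology}, real ^ 'n) chart set"
    and mul :: "'a \<Rightarrow> 'a \<Rightarrow> 'a" and e :: 'a and iv :: "'a \<Rightarrow> 'a"
    and g :: "'a \<Rightarrow> real ^ 'n \<Rightarrow> real ^ 'n \<Rightarrow> real"
    and n :: nat
  assumes "connected_lie_group A mul e iv"
    and "n = CARD('n)"
    and "riemannian_metric A g"
    and "left_invariant A mul g"
    and "unimodular A mul e"
  shows "real (dim (harmonic_cone A mul g)) =
    real n * (real n - 1) / 2 + real (dim (Kill A mul e g))"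
proof -
  interpret lie_group A mul e iv using assms(1) by unfold_locales
  note ip = riemannian_metric_inner_form[OF assms(3), of e]
  have lin: "linear (ad A mul e w)" for w using bilinear_ad by (simp add: bilinear_def)
  have uni: "(\<Sum>u\<in>E. g e (ad A mul e w u) u) = 0" if "orthonormal_basis_wrt (g e) E" for w E
    using orthonormal_trace_matrix[OF ip that lin] assms(5) by (simp add: unimodular_def)
  obtain E where E: "orthonormal_basis_wrt (g e) E" using orthonormal_basis_exists[OF ip] .
  have "finite E" "card E = CARD('n)" using orthonormal_basis_card[OF ip E] by simp_all
  then obtain \<epsilon> :: "'n \<Rightarrow> real ^ 'n" where "bij_betw \<epsilon> UNIV E"
    using finite_same_card_bij[of "UNIV :: 'n set" E] by auto
  then have \<epsilon>: "inj \<epsilon>" "orthonormal_basis_wrt (g e) (range \<epsilon>)" using E by (auto simp: bij_betw_def)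
  define K where "K w = (\<chi> i j. g e (\<epsilon> i) (ad A mul e w (\<epsilon> j)))" for w
  have "linear K"
    by (rule linearI) (simp_all add: K_def vec_eq_iff inner_form_simps[OF ip]
        bilinear_ladd[OF bilinear_ad] bilinear_lmul[OF bilinear_ad])
  moreover have "trace (K w) = 0" for w
    using uni[OF \<epsilon>(2), of w] \<epsilon>(1) inner_form_sym[OF ip] by (simp add: K_def trace_def sum.reindex)
  \<comment> \<open>The left-hand dimension is taken in a function space; linearity and injectivity
    of \<open>metric_of\<close> move it to matrices.\<close>
  moreover have "dim (harmonic_cone A mul g) =
      dim {M. transpose M = M \<and> (\<forall>x. x \<noteq> 0 \<longrightarrow> 0 < x \<bullet> (M *v x)) \<and> (\<forall>w. M \<bullet> K w = 0)}"
    unfolding K_def by (subst harmonic_cone_eq[OF assms(3,4) \<epsilon> uni], assumption)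
      (rule dim_image_eq[OF linear_metric_of inj_on_subset[OF inj_metric_of[OF assms(3,4) \<epsilon>] subset_UNIV]])
  ultimately have "dim (harmonic_cone A mul g) + CARD('n) =
      CARD('n) + (CARD('n) choose 2) + dim {w. K w + transpose (K w) = 0}"
    using dim_positive_definite_section[of K] by simp
  \<comment> \<open>The dimension of the Lie algebra cancels against the diagonal entries of the
    symmetric matrices.\<close>
  then have "dim (harmonic_cone A mul g) = (n choose 2) + dim (Kill A mul e g)"
    unfolding Kill_eq[OF assms(3,4) \<epsilon>] K_def assms(2) by simp
  then show ?thesis by (simp add: real_choose_two)
qed

end
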